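(* Let $G$ be a connected graph (loops and multiple edges allowed) with vertex set $V(G)=[n]=\{1,\dots,n\}$ and edge set $E(G)$, let $m\in[n]$, and fix a vertex ranking $\tau\in S_n$. Let $P_{G,m}(q)$ be the generating function of $(G,m)$-multiparking functions, $\overline{P}_{G,m}(q)$ the generating function of $(G,m)$-multiparking complement functions, and $I_{G,m}(q)=\sum_{F\in\mathcal{F}_{G,m}}q^{\sum_{i\in V(G)}g_F(i)}$. Then $$q^{|V(G)|}I_{G,m}(q)=\overline{P}_{G,m}(q)=q^{|E(G)|}P_{G,m}\left(\frac1q\right).$$
   Context: All graphs are finite. $\mathbb{N}$ includes $0$. For $i,j\in[n]$, $\mu_G(i,j)$ is the number of edges joining $i$ and $j$; these edges carry the distinct colors $0,1,\dots,\mu_G(i,j)-1$, and $\{i,j\}_k$ denotes the one of color $k$. For $I\subseteq[n]$, $\alpha(I,m)=\min\{i\in I:i\ge m\}$ (undefined if there is no such $i$). For $i\in I$, $\mathrm{outdeg}_I(i)$ (resp. $\mathrm{indeg}_I(i)$) is the number of edges from $i$ to vertices outside (resp. inside) $I$, and $\deg_G(i)$ is the degree of $i$; loops are counted twice in $\deg_G$ and $\mathrm{indeg}_I$, so $\deg_G(i)=\mathrm{indeg}_I(i)+\mathrm{outdeg}_I(i)$ and $\sum_i\deg_G(i)=2|E(G)|$. A $(G,m)$-multiparking function is $f:[n]\to\mathbb{N}\cup\{-1\}$ such that for every nonempty $I\subseteq[n]$ either $\alpha(I,m)$ exists and $f(\alpha(I,m))=-1$, or there is $i\in I$ with $0\le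 f(i)<\mathrm{outdeg}_I(i)$. A $(G,m)$-multiparking complement function is $h:[n]\to\mathbb{N}$ such that for every nonempty $I\subseteq[n]$ either $\alpha(I,m)$ exists and $h(\alpha(I,m))=\deg_G(\alpha(I,m))+1$, or there is $i\in I$ with $\mathrm{indeg}_I(i)<h(i)\le\deg_G(i)$. Let $\mathcal{MP}_{G,m}$ and $\overline{\mathcal{MP}}_{G,m}$ be the sets of these functions, and $$P_{G,m}(q)=\sum_{f\in\mathcal{MP}_{G,m}}q^{\sum_{i}f(i)},\qquad \overline{P}_{G,m}(q)=\sum_{h\in\overline{\mathcal{MP}}_{G,m}}q^{\sum_{i}h(i)-|E(G)|}$$ (Laurent polynomials in $q$). $\mathcal{F}_{G,m}$ is the set of spanning color $m$-forests of $G$: acyclic spanning subgraphs $F$ of $G$ (sets of colored edges together with all vertices) each of whose components contains a vertex $\ge m$. The root of a component $T$ of $F$ is $\alpha(V(T),m)$. For a non-root $v$, $\mathrm{pre}_F(v)$ is the neighbor of $v$ on the path in $F$ from $v$ to the root of its component. Order $\pi$ associated with $F$ (and $\tau$): $v_1=m$; given $V_i=\{v_1,\dots,v_i\}$, let $W_i$ be the set of vertices not in $V_i$ that are adjacent in $F$ to a vertex of $V_i$; if $W_i=\emptyset$ let $v_{i+1}=\alpha([n]\setminus V_i,m)$, otherwise let $v_{i+1}$ be the element of $W_i$ with smallest $\tau$-value. Put $\pi=v_1v_2\cdots v_n$, so $\pi^{-1}(v_i)=i$. The function $f_F=f_{F,G}$ associated with $F$: $f_F(r)=-1$ for each root $r$;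 for a non-root $v$, $f_F(v)$ is the color of the edge of $F$ joining $v$ and $\mathrm{pre}_F(v)$ plus the number of edges of $G$ joining $v$ to vertices $u$ with $\pi^{-1}(u)<\pi^{-1}(\mathrm{pre}_F(v))$. An edge $e=\{i,j\}_k$ of $G$ not in $F$ is $F$-redundant if $f_{F,G-e}=f_{F,G}$, where $G-e$ is $G$ with $e$ deleted and the remaining edges between $i$ and $j$ are recolored $0,1,\dots,\mu_G(i,j)-2$ preserving the order of their colors (with the edges of $F$ recolored accordingly). For $i\in[n]$, $g_F(i)$ is the number of $F$-redundant edges $\{i,j\}_k$ with $\pi^{-1}(j)\le\pi^{-1}(i)$ (a loop at $i$ being counted once). *)

theory Defs
  imports "HOL-Library.FuncSet" "HOL-Library.Poly_Mapping" "HOL-Combinatorics.Permutations"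
begin

(* A finite graph with vertex set {1..n}, loops and multiple edges allowed, is given by n and the
   number mult G {i,j} of edges joining i and j (mult G {i} is the number of loops at i).
   The colored edge {i,j}_k is the pair ({i,j}, k).  Values of mult G on sets that are not of the
   form {i,j} with i, j vertices are never used. *)
record multigraph =
  nverts :: nat
  mult :: "nat set \<Rightarrow> nat"

type_synonym edge = "nat set \<times> nat"

definition verts :: "multigraph \<Rightarrow> nat set" where
  "verts G = {1..nverts G}"

definition edges :: "multigraph \<Rightarrow> edge set" where
  "edges G = {({i, j}, k) | i j k. i \<in> verts G \<and> j \<in> verts G \<and> k < mult G {i, j}}"

definition adj :: "edge set \<Rightarrow> nat \<Rightarrow> nat \<Rightarrow> bool" where
  "adj F u v \<longleftrightarrow> (\<exists>k. ({u, v}, k) \<in> F)"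

definition component :: "edge set \<Rightarrow> nat \<Rightarrow> nat set" where
  "component F v = {u. (adj F)\<^sup>*\<^sup>* v u}"

definition connected_graph :: "multigraph \<Rightarrow> bool" where
  "connected_graph G \<longleftrightarrow> (\<forall>v \<in> verts G. component (edges G) v = verts G)"

(* alpha I m is only meaningful if I contains some i \<ge> m; every use is guarded accordingly. *)
definition alpha :: "nat set \<Rightarrow> nat \<Rightarrow> nat" where
  "alpha I m = Min {i \<in> I. i \<ge> m}"

definition outdeg :: "multigraph \<Rightarrow> nat set \<Rightarrow> nat \<Rightarrow> nat" where
  "outdeg G I i = (\<Sum>j \<in> verts G - I. mult G {i, j})"

(* Loops count twice in indeg and deg. *)
definition indeg :: "multigraph \<Rightarrow> nat set \<Rightarrow> nat \<Rightarrow> nat" where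
  "indeg G I i = (\<Sum>j \<in> I. if j = i then 2 * mult G {i, j} else mult G {i, j})"

definition deg :: "multigraph \<Rightarrow> nat \<Rightarrow> nat" where
  "deg G i = (\<Sum>j \<in> verts G. if j = i then 2 * mult G {i, j} else mult G {i, j})"

definition multiparking :: "multigraph \<Rightarrow> nat \<Rightarrow> (nat \<Rightarrow> int) set" where
  "multiparking G m = {f \<in> verts G \<rightarrow>\<^sub>E {-1..}. \<forall>I. I \<subseteq> verts G \<and> I \<noteq> {} \<longrightarrow>
     ((\<exists>i \<in> I. i \<ge> m) \<and> f (alpha I m) = -1) \<or>
     (\<exists>i \<in> I. 0 \<le> f i \<and> f i < int (outdeg G I i))}"

definition multiparking_compl :: "multigraph \<Rightarrow> nat \<Rightarrow> (nat \<Rightarrow> nat) set" where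
  "multiparking_compl G m = {h \<in> verts G \<rightarrow>\<^sub>E UNIV. \<forall>I. I \<subseteq> verts G \<and> I \<noteq> {} \<longrightarrow>
     ((\<exists>i \<in> I. i \<ge> m) \<and> h (alpha I m) = deg G (alpha I m) + 1) \<or>
     (\<exists>i \<in> I. indeg G I i < h i \<and> h i \<le> deg G i)}"

(* The ring of integral Laurent polynomials in q: finitely supported maps from exponents to
   coefficients, with the convolution product of Poly_Mapping. *)
type_synonym laurent = "int \<Rightarrow>\<^sub>0 int"

(* The monomial q^k. *)
definition qpow :: "int \<Rightarrow> laurent" where
  "qpow k = Poly_Mapping.single k 1"

(* p(1/q): each monomial c q^k of p(q) is replaced by c (1/q)^k = c q^(-k). *)
definition subst_inverse_q :: "laurent \<Rightarrow> laurent" where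
  "subst_inverse_q p =
     (\<Sum>k \<in> Poly_Mapping.keys p. Poly_Mapping.single (- k) (Poly_Mapping.lookup p k))"

definition P_poly :: "multigraph \<Rightarrow> nat \<Rightarrow> laurent" where
  "P_poly G m = (\<Sum>f \<in> multiparking G m. qpow (\<Sum>i \<in> verts G. f i))"

definition Pbar_poly :: "multigraph \<Rightarrow> nat \<Rightarrow> laurent" where
  "Pbar_poly G m = (\<Sum>h \<in> multiparking_compl G m.
     qpow (int (\<Sum>i \<in> verts G. h i) - int (card (edges G))))"

(* Distinct edges es ! 0, es ! 1, ... join cyclically consecutive distinct vertices of vs.
   Length 1 is a loop, length 2 a pair of parallel edges. *)
definition is_cycle :: "edge set \<Rightarrow> nat list \<Rightarrow> edge list \<Rightarrow> bool" where
  "is_cycle F vs es \<longleftrightarrow>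
     es \<noteq> [] \<and> length vs = length es \<and> distinct vs \<and> distinct es \<and> set es \<subseteq> F \<and>
     (\<forall>i < length es. fst (es ! i) = {vs ! i, vs ! (Suc i mod length vs)})"

(* Spanning subgraphs of G are identified with their edge sets. *)
definition forests :: "multigraph \<Rightarrow> nat \<Rightarrow> edge set set" where
  "forests G m = {F. F \<subseteq> edges G \<and> (\<nexists>vs es. is_cycle F vs es) \<and>
     (\<forall>v \<in> verts G. \<exists>u \<in> component F v. u \<ge> m)}"

definition forest_root :: "edge set \<Rightarrow> nat \<Rightarrow> nat \<Rightarrow> nat" where
  "forest_root F m v = alpha (component F v) m"

definition pre_vertex :: "edge set \<Rightarrow> nat \<Rightarrow> nat \<Rightarrow> nat" where
  "pre_vertex F m v = (THE u. \<exists>p. distinct (v # u # p) \<and> successively (adj F) (v # u # p) \<and>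
     last (v # u # p) = forest_root F m v)"

definition next_vertex ::
    "multigraph \<Rightarrow> nat \<Rightarrow> (nat \<Rightarrow> nat) \<Rightarrow> edge set \<Rightarrow> nat set \<Rightarrow> nat" where
  "next_vertex G m \<tau> F S =
     (let W = {w \<in> verts G - S. \<exists>u \<in> S. adj F u w}
      in if W = {} then alpha (verts G - S) m else arg_min_on \<tau> W)"

(* order_prefix G m \<tau> F i is the list v_1, ..., v_{i+1}. *)
primrec order_prefix ::
    "multigraph \<Rightarrow> nat \<Rightarrow> (nat \<Rightarrow> nat) \<Rightarrow> edge set \<Rightarrow> nat \<Rightarrow> nat list" where
  "order_prefix G m \<tau> F 0 = [m]"
| "order_prefix G m \<tau> F (Suc i) =
     order_prefix G m \<tau> F i @ [next_vertex G m \<tau> F (set (order_prefix G m \<tau> F i))]"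

definition order_list :: "multigraph \<Rightarrow> nat \<Rightarrow> (nat \<Rightarrow> nat) \<Rightarrow> edge set \<Rightarrow> nat list" where
  "order_list G m \<tau> F = order_prefix G m \<tau> F (nverts G - 1)"

(* position G m \<tau> F v is the (1-based) index of v in the order, i.e. the value at v of the inverse
   of the permutation associated with F. *)
definition position :: "multigraph \<Rightarrow> nat \<Rightarrow> (nat \<Rightarrow> nat) \<Rightarrow> edge set \<Rightarrow> nat \<Rightarrow> nat" where
  "position G m \<tau> F v = (THE i. i \<in> {1..nverts G} \<and> order_list G m \<tau> F ! (i - 1) = v)"

definition forest_fun ::
    "multigraph \<Rightarrow> nat \<Rightarrow> (nat \<Rightarrow> nat) \<Rightarrow> edge set \<Rightarrow> nat \<Rightarrow> int" where
  "forest_fun G m \<tau> F = (\<lambda>v \<in> verts G.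
     if v = forest_root F m v then -1
     else int ((THE k. ({v, pre_vertex F m v}, k) \<in> F) +
       (\<Sum>u | u \<in> verts G \<and> position G m \<tau> F u < position G m \<tau> F (pre_vertex F m v). mult G {v, u})))"

definition delete_edge :: "multigraph \<Rightarrow> edge \<Rightarrow> multigraph" where
  "delete_edge G e = G\<lparr>mult := (mult G)(fst e := mult G (fst e) - 1)\<rparr>"

(* The recoloring of the remaining edges caused by the deletion of e. *)
definition recolor :: "edge \<Rightarrow> edge \<Rightarrow> edge" where
  "recolor e d = (if fst d = fst e \<and> snd d > snd e then (fst d, snd d - 1) else d)"

definition redundant ::
    "multigraph \<Rightarrow> nat \<Rightarrow> (nat \<Rightarrow> nat) \<Rightarrow> edge set \<Rightarrow> edge \<Rightarrow> bool" where
  "redundant G m \<tau> F e \<longleftrightarrow> e \<in> edges G - F \<and>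
     forest_fun (delete_edge G e) m \<tau> (recolor e ` F) = forest_fun G m \<tau> F"

definition redundant_count :: "multigraph \<Rightarrow> nat \<Rightarrow> (nat \<Rightarrow> nat) \<Rightarrow> edge set \<Rightarrow> nat \<Rightarrow> nat" where
  "redundant_count G m \<tau> F i = card {e. redundant G m \<tau> F e \<and>
     (\<exists>j \<in> verts G. fst e = {i, j} \<and> position G m \<tau> F j \<le> position G m \<tau> F i)}"

definition I_poly :: "multigraph \<Rightarrow> nat \<Rightarrow> (nat \<Rightarrow> nat) \<Rightarrow> laurent" where
  "I_poly G m \<tau> = (\<Sum>F \<in> forests G m. qpow (int (\<Sum>i \<in> verts G. redundant_count G m \<tau> F i)))"

end

theory Submission
  imports Defs
begin

text \<open>
  Both identities hold term by term. The second one comes from the bijection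
  \<open>h i = deg G i - f i\<close> between multiparking functions and complement functions
  (\<open>bij_betw_complement\<close>), together with the handshake lemma. The first one combines a bijection
  between forests and multiparking functions with a count of the redundant edges.

  Everything rests on one reading of the function \<open>f\<close> associated with a forest \<open>F\<close>. In the order of
  \<open>F\<close> the parent of a non-root precedes it. List the edges of \<open>G\<close> at a non-root \<open>v\<close> by the position
  of their other end and, among parallel edges, by color: then \<open>f v\<close> is the number of edges that
  precede the edge from \<open>v\<close> to its parent. So a vertex \<open>w\<close> outside an initial segment \<open>S\<close> of the
  order has its parent in \<open>S\<close> if and only if \<open>0 \<le> f w\<close> and \<open>f w\<close> is smaller than the number of edges
  from \<open>w\<close> to \<open>S\<close> (\<open>parking_fun_frontier\<close>).

  Consequently the search that produces the order can be run from \<open>f\<close> alone, which recovers first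
  the order and then every parent edge: the map is injective. The search can also be run from an
  arbitrary multiparking function. If no vertex outside the visited set \<open>S\<close> is reachable, then the
  multiparking condition for the complement of \<open>S\<close> says precisely that the vertex with which the
  search restarts has value \<open>-1\<close>, that is, may be declared a root. This makes the map
  surjective (\<open>bij_betw_forest_fun\<close>).

  The order depends only on adjacency in \<open>F\<close>, so it survives the deletion of an edge outside \<open>F\<close>. By
  the reading above, the deletion changes \<open>f\<close> exactly when the edge is one of the \<open>f v\<close> edges in
  front of the parent edge of some non-root \<open>v\<close>. Such an edge has \<open>v\<close> as its later end, so these
  edge sets are disjoint. Counting the edges of \<open>G\<close>, and using that a forest has one edge for each
  non-root, one finds that the number of vertices plus the number of redundant edges equals the
  number of edges minus the sum of \<open>f\<close> over all vertices (\<open>redundant_weight\<close>); the value \<open>-1\<close> at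
  the roots makes up for the missing edges.
\<close>

section \<open>Greedy vertex orders\<close>

text \<open>
  The order of a forest and the order computed from a multiparking function are produced by the same
  loop with different choice functions \<open>N\<close>; isolating the loop allows the two to be compared.
\<close>

primrec greedy :: "('a set \<Rightarrow> 'a) \<Rightarrow> nat \<Rightarrow> 'a list" where
  "greedy N 0 = []"
| "greedy N (Suc i) = greedy N i @ [N (set (greedy N i))]"

definition rank :: "('a set \<Rightarrow> 'a) \<Rightarrow> 'a set \<Rightarrow> 'a \<Rightarrow> nat" where
  "rank N V v = (THE i. i \<in> {1..card V} \<and> greedy N (card V) ! (i - 1) = v)"

definition before :: "('a \<Rightarrow> nat) \<Rightarrow> 'a set \<Rightarrow> 'a \<Rightarrow> 'a set" where
  "before pos V v = {u \<in> V. pos u < pos v}"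

lemma length_greedy [simp]: "length (greedy N i) = i"
  by (induction i) auto

lemma take_greedy: "i \<le> j \<Longrightarrow> take i (greedy N j) = greedy N i"
proof (induction j)
  case (Suc j)
  then show ?case by (cases "i = Suc j") auto
qed simp

lemma nth_greedy: "i < j \<Longrightarrow> greedy N j ! i = N (set (greedy N i))"
  by (induction j) (auto simp: nth_append less_Suc_eq)

lemma greedy_distinct:
  assumes "finite V" and "\<And>S. S \<subset> V \<Longrightarrow> N S \<in> V - S" and "i \<le> card V"
  shows "distinct (greedy N i) \<and> set (greedy N i) \<subseteq> V"
  using assms(3)
proof (induction i)
  case (Suc i)
  then have IH: "distinct (greedy N i)" "set (greedy N i) \<subseteq> V" by auto
  have "card (set (greedy N i)) = i" using IH(1) by (simp add: distinct_card)
  then have "set (greedy N i) \<noteq> V" using Suc.prems by auto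
  then have "N (set (greedy N i)) \<in> V - set (greedy N i)" using assms(2) IH(2) by blast
  then show ?case using IH by auto
qed simp

text \<open>
  The order can be described without lists: each vertex is the choice made by \<open>N\<close> on the set of
  vertices that precede it. All later arguments use only this fixed-point property.
\<close>

lemma rank_greedy:
  assumes fin: "finite V" and step: "\<And>S. S \<subset> V \<Longrightarrow> N S \<in> V - S"
  shows inj_on_rank: "inj_on (rank N V) V"
    and rank_step: "v \<in> V \<Longrightarrow> N (before (rank N V) V v) = v"
    and greedy_before: "i < card V \<Longrightarrow> \<exists>v\<in>V. set (greedy N i) = before (rank N V) V v"
proof -
  let ?L = "greedy N (card V)"
  have dist: "distinct ?L" and sub: "set ?L \<subseteq> V" using greedy_distinct[OF fin step] by auto
  have card: "card (set ?L) = card V" using dist by (simp add: distinct_card)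
  have setL: "set ?L = V" using card_subset_eq[OF fin sub card] .
  have rank_nth: "rank N V (?L ! i) = Suc i" if "i < card V" for i
    unfolding rank_def
  proof (rule the_equality)
    show "Suc i \<in> {1..card V} \<and> ?L ! (Suc i - 1) = ?L ! i" using that by auto
  next
    fix j assume j: "j \<in> {1..card V} \<and> ?L ! (j - 1) = ?L ! i"
    then have "j - 1 = i" using nth_eq_iff_index_eq[OF dist, of "j - 1" i] that by auto
    then show "j = Suc i" using j by auto
  qed
  have ex: "\<exists>i<card V. v = ?L ! i" if "v \<in> V" for v
    using that setL by (metis in_set_conv_nth length_greedy)
  show "inj_on (rank N V) V"
    by (rule inj_onI) (metis ex rank_nth Suc_inject)
  have bef: "before (rank N V) V (?L ! i) = set (greedy N i)" if i: "i < card V" for i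
  proof -
    have "set (greedy N i) = set (take i ?L)" using take_greedy[of i "card V" N] i by simp
    also have "\<dots> = (!) ?L ` {0..<i}" using i by (intro nth_image[symmetric]) simp
    also have "\<dots> = before (rank N V) V (?L ! i)"
    proof (intro equalityI subsetI)
      fix x assume "x \<in> (!) ?L ` {0..<i}"
      then obtain j where "j < i" "x = ?L ! j" by auto
      moreover from this have "x \<in> V" using setL i by (metis length_greedy less_trans nth_mem)
      ultimately show "x \<in> before (rank N V) V (?L ! i)" using i rank_nth by (simp add: before_def)
    next
      fix x assume x: "x \<in> before (rank N V) V (?L ! i)"
      then obtain j where j: "j < card V" "x = ?L ! j" using ex by (auto simp: before_def)
      then have "j < i" using x rank_nth i by (simp add: before_def)
      then show "x \<in> (!) ?L ` {0..<i}" using j by auto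
    qed
    finally show ?thesis by simp
  qed
  show "N (before (rank N V) V v) = v" if v: "v \<in> V"
  proof -
    obtain i where "i < card V" "v = ?L ! i" using ex v by auto
    then show ?thesis using bef nth_greedy by metis
  qed
  show "\<exists>v\<in>V. set (greedy N i) = before (rank N V) V v" if i: "i < card V"
    using bef[OF i] i setL by (metis length_greedy nth_mem)
qed

text \<open>
  Two choice functions need to agree only on the sets visited by one of them. This matters because
  the choices made from a forest and from its function may differ on sets that are not initial segments.
\<close>

lemma rank_cong:
  assumes fin: "finite V" and step: "\<And>S. S \<subset> V \<Longrightarrow> N S \<in> V - S"
    and agree: "\<And>v. v \<in> V \<Longrightarrow> N' (before (rank N V) V v) = N (before (rank N V) V v)"
  shows "rank N' V = rank N V"
proof -
  have "greedy N' i = greedy N i" if "i \<le> card V" for i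
    using that
  proof (induction i)
    case (Suc i)
    then show ?case using greedy_before[OF fin step, of i] agree by fastforce
  qed simp
  then show ?thesis by (simp add: rank_def fun_eq_iff)
qed

section \<open>Vertices and edges\<close>

lemma finite_verts [simp]: "finite (verts G)"
  by (simp add: verts_def)

lemma card_verts: "card (verts G) = nverts G"
  by (simp add: verts_def)

lemma alpha_least:
  assumes "finite I" "\<exists>i\<in>I. i \<ge> m"
  shows "alpha I m \<in> I \<and> m \<le> alpha I m \<and> (\<forall>i\<in>I. m \<le> i \<longrightarrow> alpha I m \<le> i)"
proof -
  have "finite {i \<in> I. i \<ge> m}" "{i \<in> I. i \<ge> m} \<noteq> {}" using assms by auto
  then show ?thesis unfolding alpha_def using Min_in Min_le by blast
qed

lemma alpha_eqI:
  assumes "finite I" "r \<in> I" "m \<le> r" "\<And>i. i \<in> I \<Longrightarrow> m \<le> i \<Longrightarrow> r \<le> i"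
  shows "alpha I m = r"
  unfolding alpha_def using assms by (intro Min_eqI) auto

lemma finite_edges [simp]: "finite (edges G)"
proof -
  have "edges G = (\<Union>i\<in>verts G. \<Union>j\<in>verts G. (\<lambda>k. ({i, j}, k)) ` {..<mult G {i, j}})"
    by (auto simp: edges_def)
  then show ?thesis by simp
qed

lemma edgeI: "i \<in> verts G \<Longrightarrow> j \<in> verts G \<Longrightarrow> k < mult G {i, j} \<Longrightarrow> ({i, j}, k) \<in> edges G"
  by (auto simp: edges_def)

lemma adj_sym: "adj F u v \<Longrightarrow> adj F v u"
  by (simp add: adj_def insert_commute)

lemma adj_rtranclp_sym: "(adj F)\<^sup>*\<^sup>* u v \<Longrightarrow> (adj F)\<^sup>*\<^sup>* v u"
  by (induction rule: rtranclp_induct) (auto intro: converse_rtranclp_into_rtranclp adj_sym)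

lemma component_eq:
  assumes "(adj F)\<^sup>*\<^sup>* u v"
  shows "component F u = component F v"
  using assms adj_rtranclp_sym[OF assms] unfolding component_def
  by (auto intro: rtranclp_trans)

lemma edge_verts:
  assumes "F \<subseteq> edges G" "({a, b}, k) \<in> F"
  shows "a \<in> verts G" "b \<in> verts G" "k < mult G {a, b}"
proof -
  obtain i j where "{a, b} = {i, j}" "i \<in> verts G" "j \<in> verts G" "k < mult G {i, j}"
    using assms unfolding edges_def by blast
  then show "a \<in> verts G" "b \<in> verts G" by (auto simp: doubleton_eq_iff)
  show "k < mult G {a, b}" using \<open>k < mult G {i, j}\<close> \<open>{a, b} = {i, j}\<close> by simp
qed

lemma adj_closed:
  assumes "(adj F)\<^sup>*\<^sup>* u v" "u \<in> S" "\<And>x y. x \<in> S \<Longrightarrow> adj F x y \<Longrightarrow> y \<in> S"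
  shows "v \<in> S"
  using assms by (induction rule: rtranclp_induct) auto

section \<open>The vertex order of a forest is greedy\<close>

definition forest_frontier :: "multigraph \<Rightarrow> edge set \<Rightarrow> nat set \<Rightarrow> nat set" where
  "forest_frontier G F S = {w \<in> verts G - S. \<exists>u \<in> S. adj F u w}"

lemma next_vertex_frontier:
  "next_vertex G m \<tau> F S = (if forest_frontier G F S = {} then alpha (verts G - S) m
     else arg_min_on \<tau> (forest_frontier G F S))"
  unfolding next_vertex_def forest_frontier_def Let_def ..

text \<open>
  The order starts with \<open>m\<close>, which is also the choice made on the empty set; hence it is a greedy
  order from the first vertex on.
\<close>

lemma position_eq_rank:
  assumes m: "m \<in> verts G"
  shows "position G m \<tau> F = rank (next_vertex G m \<tau> F) (verts G)"
proof -
  have first: "next_vertex G m \<tau> F {} = m"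
    using m by (auto simp: next_vertex_def intro: alpha_eqI)
  have "order_prefix G m \<tau> F i = greedy (next_vertex G m \<tau> F) (Suc i)" for i
    by (induction i) (auto simp: first)
  moreover have "nverts G = Suc (nverts G - 1)" using m by (auto simp: verts_def)
  ultimately have "order_list G m \<tau> F = greedy (next_vertex G m \<tau> F) (nverts G)"
    unfolding order_list_def by metis
  then show ?thesis by (simp add: fun_eq_iff position_def rank_def card_verts)
qed

text \<open>
  A set with empty frontier is a union of components, and so is its complement, which therefore
  contains a vertex \<open>\<ge> m\<close>. So the search can always restart.
\<close>

lemma large_vertex_outside:
  assumes F: "F \<in> forests G m" and S: "S \<subset> verts G" and empty: "forest_frontier G F S = {}"
  shows "\<exists>u\<in>verts G - S. m \<le> u"
proof -
  obtain v where v: "v \<in> verts G" "v \<notin> S" using S by auto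
  obtain u where u: "(adj F)\<^sup>*\<^sup>* v u" "m \<le> u"
    using F v(1) by (auto simp: forests_def component_def)
  have sub: "F \<subseteq> edges G" using F by (simp add: forests_def)
  have "u \<in> verts G - S"
    using u(1)
  proof (rule adj_closed)
    fix x y assume xy: "x \<in> verts G - S" "adj F x y"
    then have "y \<in> verts G" using edge_verts[OF sub] unfolding adj_def by blast
    then show "y \<in> verts G - S"
      using empty xy adj_sym unfolding forest_frontier_def by blast
  qed (use v in auto)
  then show ?thesis using u(2) by blast
qed

lemma arg_min_frontier:
  fixes \<tau> :: "nat \<Rightarrow> nat"
  assumes "forest_frontier G F S \<noteq> {}"
  shows "arg_min_on \<tau> (forest_frontier G F S) \<in> forest_frontier G F S"
proof -
  have "finite (forest_frontier G F S)" by (simp add: forest_frontier_def)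
  then show ?thesis using arg_min_if_finite(1)[of _ \<tau>] assms by blast
qed

lemma next_vertex_new:
  assumes F: "F \<in> forests G m" and S: "S \<subset> verts G"
  shows "next_vertex G m \<tau> F S \<in> verts G - S"
proof (cases "forest_frontier G F S = {}")
  case True
  then show ?thesis
    using alpha_least[of "verts G - S" m] large_vertex_outside[OF F S]
    by (auto simp: next_vertex_frontier)
next
  case False
  then show ?thesis using arg_min_frontier[OF False]
    by (auto simp: next_vertex_frontier forest_frontier_def)
qed

section \<open>Forests given by parents\<close>

lemma successively_rtranclp: "successively P (x # xs) \<Longrightarrow> P\<^sup>*\<^sup>* x (last (x # xs))"
proof (induction xs arbitrary: x)
  case (Cons y ys)
  then have "P x y" "P\<^sup>*\<^sup>* y (last (y # ys))" by simp_all
  then show ?case by (simp add: converse_rtranclp_into_rtranclp)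
qed simp

definition joins :: "multigraph \<Rightarrow> nat \<Rightarrow> nat set \<Rightarrow> nat" where
  "joins G v S = (\<Sum>u\<in>S. mult G {v, u})"

lemma joins_mono: "S \<subseteq> T \<Longrightarrow> finite T \<Longrightarrow> joins G v S \<le> joins G v T"
  unfolding joins_def by (rule sum_mono2) auto

lemma joins_before_le:
  assumes "u \<in> S" "before pos (verts G) u \<subseteq> S" "finite S"
  shows "joins G v (before pos (verts G) u) + mult G {v, u} \<le> joins G v S"
proof -
  have "joins G v (insert u (before pos (verts G) u)) \<le> joins G v S"
    using assms by (intro joins_mono) auto
  moreover have "u \<notin> before pos (verts G) u" "finite (before pos (verts G) u)"
    by (auto simp: before_def)
  ultimately show ?thesis by (simp add: joins_def)
qed

text \<open>
  A forest together with a vertex order in which parents precede their children: \<open>R\<close> is the set of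
  roots, and the non-root \<open>v\<close> hangs on \<open>p v\<close> by the edge of color \<open>c v\<close>. The last assumption says
  that no edge joins a vertex before a root to the root or to a vertex after it, so that each
  component is an interval of the order that starts with its root; the last but one makes this root
  the prescribed vertex of its component. Both forests and multiparking functions give rise to
  such data.
\<close>

locale parent_forest =
  fixes G :: multigraph and m :: nat and pos :: "nat \<Rightarrow> nat" and R :: "nat set"
    and p :: "nat \<Rightarrow> nat" and c :: "nat \<Rightarrow> nat"
  assumes inj_pos: "inj_on pos (verts G)"
    and roots: "R \<subseteq> verts G"
    and parent: "v \<in> verts G - R \<Longrightarrow> p v \<in> verts G \<and> pos (p v) < pos v \<and> c v < mult G {v, p v}"
    and root_least: "r \<in> R \<Longrightarrow> m \<le> r \<and> (\<forall>u\<in>verts G. m \<le> u \<longrightarrow> pos r \<le> pos u \<longrightarrow> r \<le> u)"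
    and root_separates: "r \<in> R \<Longrightarrow> v \<in> verts G - R \<Longrightarrow> pos r \<le> pos v \<Longrightarrow> pos r \<le> pos (p v)"
begin

definition parent_edges :: "edge set" where
  "parent_edges = (\<lambda>v. ({v, p v}, c v)) ` (verts G - R)"

definition parking_fun :: "nat \<Rightarrow> int" where
  "parking_fun = (\<lambda>v\<in>verts G. if v \<in> R then -1
     else int (c v + joins G v (before pos (verts G) (p v))))"

lemma parent_edges_subset: "parent_edges \<subseteq> edges G"
  using parent unfolding parent_edges_def edges_def by auto

lemma adj_parent_edges:
  "adj parent_edges u v \<longleftrightarrow> (u \<in> verts G - R \<and> v = p u) \<or> (v \<in> verts G - R \<and> u = p v)"
proof
  assume "adj parent_edges u v"
  then show "(u \<in> verts G - R \<and> v = p u) \<or> (v \<in> verts G - R \<and> u = p v)"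
    by (auto simp: adj_def parent_edges_def doubleton_eq_iff)
next
  assume "(u \<in> verts G - R \<and> v = p u) \<or> (v \<in> verts G - R \<and> u = p v)"
  then show "adj parent_edges u v"
    by (auto simp: adj_def parent_edges_def insert_commute)
qed

text \<open>
  This is why parent edges form no cycle and why the edges counted by \<open>parking_fun\<close> are not parent
  edges: each vertex is the later end of at most one parent edge, its own.
\<close>

lemma parent_edge_later_endpoint:
  assumes "e \<in> parent_edges" "fst e = {x, y}" "pos y \<le> pos x"
  shows "x \<in> verts G - R \<and> y = p x \<and> e = ({x, p x}, c x)"
proof -
  obtain w where w: "w \<in> verts G - R" "e = ({w, p w}, c w)"
    using assms(1) by (auto simp: parent_edges_def)
  then have "{w, p w} = {x, y}" using assms(2) by simp
  then show ?thesis using w parent[OF w(1)] assms(3) by (auto simp: doubleton_eq_iff)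
qed

lemma ancestor_path:
  assumes "v \<in> verts G"
  shows "\<exists>xs. distinct (v # xs) \<and> successively (adj parent_edges) (v # xs) \<and> last (v # xs) \<in> R \<and>
    (\<forall>x\<in>set xs. pos x < pos v) \<and> (v \<notin> R \<longrightarrow> xs \<noteq> [] \<and> hd xs = p v)"
  using assms
proof (induction "pos v" arbitrary: v rule: less_induct)
  case less
  show ?case
  proof (cases "v \<in> R")
    case True
    then show ?thesis by (intro exI[of _ "[]"]) auto
  next
    case False
    then have v: "v \<in> verts G - R" using less.prems by simp
    note par = parent[OF v]
    obtain xs where xs: "distinct (p v # xs)" "successively (adj parent_edges) (p v # xs)"
      "last (p v # xs) \<in> R" "\<forall>x\<in>set xs. pos x < pos (p v)"
      using less.hyps[of "p v"] par by blast
    have "\<forall>x\<in>set (p v # xs). pos x < pos v" using xs(4) par by auto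
    then show ?thesis using xs v
      by (intro exI[of _ "p v # xs"]) (auto simp: adj_parent_edges)
  qed
qed

text \<open>
  The vertices from a root onwards are closed under adjacency, since edges do not cross a root.
\<close>

lemma root_component:
  assumes "r \<in> R" "u \<in> component parent_edges r"
  shows "u \<in> verts G \<and> pos r \<le> pos u"
proof -
  have "(adj parent_edges)\<^sup>*\<^sup>* r u" using assms(2) by (simp add: component_def)
  then have "u \<in> {u \<in> verts G. pos r \<le> pos u}"
  proof (rule adj_closed)
    show "r \<in> {u \<in> verts G. pos r \<le> pos u}" using assms(1) roots by auto
    fix x y assume x: "x \<in> {u \<in> verts G. pos r \<le> pos u}" and "adj parent_edges x y"
    then consider "x \<in> verts G - R" "y = p x" | "y \<in> verts G - R" "x = p y"
      by (auto simp: adj_parent_edges)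
    then show "y \<in> {u \<in> verts G. pos r \<le> pos u}"
    proof cases
      case 1
      then show ?thesis using x root_separates[OF assms(1)] parent[of x] by auto
    next
      case 2
      then show ?thesis using x parent[of y] by auto
    qed
  qed
  then show ?thesis by simp
qed

lemma forest_root_of_root:
  assumes "r \<in> R"
  shows "forest_root parent_edges m r = r"
  unfolding forest_root_def
proof (rule alpha_eqI)
  show "finite (component parent_edges r)"
    using root_component[OF assms] by (meson finite_subset finite_verts subsetI)
  show "r \<in> component parent_edges r" by (simp add: component_def)
  show "m \<le> r" using root_least[OF assms] by simp
  show "r \<le> i" if "i \<in> component parent_edges r" "m \<le> i" for i
    using root_least[OF assms] root_component[OF assms that(1)] that(2) by simp
qed

lemma reaches_root:
  assumes "v \<in> verts G"
  shows "\<exists>r\<in>R. (adj parent_edges)\<^sup>*\<^sup>* v r"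
  using ancestor_path[OF assms] successively_rtranclp by meson

lemma forest_root_reached:
  assumes "(adj parent_edges)\<^sup>*\<^sup>* v r" "r \<in> R"
  shows "forest_root parent_edges m v = r"
  using component_eq[OF assms(1)] forest_root_of_root[OF assms(2)] by (simp add: forest_root_def)

lemma forest_root_iff:
  assumes "v \<in> verts G"
  shows "v = forest_root parent_edges m v \<longleftrightarrow> v \<in> R"
  using reaches_root[OF assms] forest_root_reached forest_root_of_root by metis

text \<open>
  A simple path that starts with a step from a parent to a child can never turn back, so all its
  later vertices are non-roots. Hence the path from \<open>v\<close> to its root must begin with \<open>p v\<close>.
\<close>

lemma leaving_downwards:
  assumes "successively (adj parent_edges) (x # y # ys)" "distinct (x # y # ys)"
    "p y = x" "y \<in> verts G - R"
  shows "last (y # ys) \<notin> R"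
  using assms
proof (induction ys arbitrary: x y)
  case (Cons z zs)
  have "z \<noteq> p y" using Cons.prems by auto
  then have "z \<in> verts G - R" "p z = y" using Cons.prems(1) by (auto simp: adj_parent_edges)
  then show ?case using Cons.IH[of y z] Cons.prems by auto
qed simp

lemma pre_vertex_parent:
  assumes v: "v \<in> verts G - R"
  shows "pre_vertex parent_edges m v = p v"
proof -
  obtain xs where xs: "distinct (v # xs)" "successively (adj parent_edges) (v # xs)"
    "last (v # xs) \<in> R" "xs \<noteq> []" "hd xs = p v"
    using ancestor_path[of v] v by blast
  then obtain ys where ys: "xs = p v # ys" by (metis list.collapse)
  have "(adj parent_edges)\<^sup>*\<^sup>* v (last (v # xs))" by (rule successively_rtranclp[OF xs(2)])
  then have root: "forest_root parent_edges m v = last (v # xs)"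
    using forest_root_reached xs(3) by blast
  show ?thesis
    unfolding pre_vertex_def
  proof (rule the_equality)
    show "\<exists>q. distinct (v # p v # q) \<and> successively (adj parent_edges) (v # p v # q) \<and>
      last (v # p v # q) = forest_root parent_edges m v"
      using xs(1,2) root by (intro exI[of _ ys]) (simp add: ys)
  next
    fix u
    assume "\<exists>q. distinct (v # u # q) \<and> successively (adj parent_edges) (v # u # q) \<and>
      last (v # u # q) = forest_root parent_edges m v"
    then obtain q where q: "distinct (v # u # q)" "successively (adj parent_edges) (v # u # q)"
      "last (u # q) \<in> R" using root xs(3) by auto
    then have "adj parent_edges v u" by simp
    then show "u = p v" using leaving_downwards[OF q(2,1)] q(3) by (auto simp: adj_parent_edges)
  qed
qed

text \<open>
  A cycle would enter and leave its latest vertex through two distinct edges to vertices that are no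
  later, but both would have to be the parent edge of that vertex.
\<close>

lemma parent_edges_forest: "parent_edges \<in> forests G m"
proof -
  have "\<not> is_cycle parent_edges vs es" for vs es
  proof
    assume cyc: "is_cycle parent_edges vs es"
    define L where "L = length es"
    have L: "L > 0" "length vs = L" "distinct es" "set es \<subseteq> parent_edges"
      and ends: "\<And>i. i < L \<Longrightarrow> fst (es ! i) = {vs ! i, vs ! (Suc i mod L)}"
      using cyc unfolding is_cycle_def L_def by auto
    (* i is the index of the latest vertex of the cycle, j its cyclic predecessor. *)
    define M where "M = Max ((\<lambda>i. pos (vs ! i)) ` {..<L})"
    have "M \<in> (\<lambda>i. pos (vs ! i)) ` {..<L}"
      unfolding M_def using L(1) by (intro Max_in) auto
    then obtain i where i: "i < L" "pos (vs ! i) = M" by auto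
    have top: "pos (vs ! j) \<le> pos (vs ! i)" if "j < L" for j
      unfolding i(2) M_def using that by (intro Max_ge) auto
    define j where "j = (if i = 0 then L - 1 else i - 1)"
    have j: "j < L" "Suc j mod L = i" using i(1) by (auto simp: j_def)
    have in_edges: "es ! i \<in> parent_edges" "es ! j \<in> parent_edges"
      using L(4) i(1) j(1) by (auto simp: L_def)
    have ei: "vs ! (Suc i mod L) = p (vs ! i)" "vs ! i \<in> verts G - R"
      "es ! i = ({vs ! i, p (vs ! i)}, c (vs ! i))"
      using parent_edge_later_endpoint[OF in_edges(1) ends[OF i(1)]] top[of "Suc i mod L"] L(1)
      by auto
    have "fst (es ! j) = {vs ! i, vs ! j}" using ends[OF j(1)] j(2) by (simp add: insert_commute)
    then have "es ! j = es ! i"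
      using parent_edge_later_endpoint[OF in_edges(2)] top[OF j(1)] ei(3) by auto
    then have "j = i" using L(3) i(1) j(1) nth_eq_iff_index_eq L_def by metis
    then have "Suc i mod L = i" using j(2) by simp
    then show False using ei(1) parent[OF ei(2)] by simp
  qed
  moreover have "\<exists>u\<in>component parent_edges v. m \<le> u" if "v \<in> verts G" for v
    using reaches_root[OF that] root_least by (auto simp: component_def)
  ultimately show ?thesis using parent_edges_subset by (auto simp: forests_def)
qed

lemma edge_color:
  assumes "v \<in> verts G - R"
  shows "(THE k. ({v, p v}, k) \<in> parent_edges) = c v"
proof (rule the_equality)
  show "({v, p v}, c v) \<in> parent_edges" using assms by (auto simp: parent_edges_def)
  show "k = c v" if "({v, p v}, k) \<in> parent_edges" for k
    using parent_edge_later_endpoint[OF that, of v "p v"] parent[OF assms] by auto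
qed

lemma forest_fun_parking_fun:
  assumes "\<And>v. v \<in> verts G \<Longrightarrow> position G m \<tau> parent_edges v = pos v"
  shows "forest_fun G m \<tau> parent_edges = parking_fun"
proof
  fix v
  show "forest_fun G m \<tau> parent_edges v = parking_fun v"
  proof (cases "v \<in> verts G - R")
    case True
    then have "{u \<in> verts G. position G m \<tau> parent_edges u < position G m \<tau> parent_edges (p v)}
        = before pos (verts G) (p v)"
      using assms parent[OF True] by (auto simp: before_def)
    then show ?thesis
      using True forest_root_iff[of v] 
      by (simp add: forest_fun_def parking_fun_def pre_vertex_parent edge_color joins_def)
  next
    case False
    then show ?thesis using forest_root_iff[of v] by (auto simp: forest_fun_def parking_fun_def)
  qed
qed

text \<open>
  The value of \<open>parking_fun\<close> at a non-root \<open>w\<close> is at least the number of edges from \<open>w\<close> to vertices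
  before \<open>p w\<close>, and the color bound makes it less than the number of edges to vertices up to \<open>p w\<close>.
  For an initial segment \<open>S\<close> this decides whether \<open>p w\<close> belongs to \<open>S\<close>.
\<close>

lemma parking_fun_frontier:
  assumes w: "w \<in> verts G" and S: "S = before pos (verts G) v" and "w \<notin> S"
  shows "0 \<le> parking_fun w \<and> parking_fun w < int (joins G w S) \<longleftrightarrow> (\<exists>u\<in>S. adj parent_edges u w)"
proof (cases "w \<in> R")
  case True
  have "\<not> (\<exists>u\<in>S. adj parent_edges u w)"
  proof
    assume "\<exists>u\<in>S. adj parent_edges u w"
    then obtain u where u: "u \<in> S" "u \<in> verts G - R" "w = p u"
      using True by (auto simp: adj_parent_edges)
    then have "pos w < pos u" using parent by auto
    then show False using u(1) assms by (auto simp: before_def)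
  qed
  then show ?thesis using True w by (simp add: parking_fun_def)
next
  case False
  then have nr: "w \<in> verts G - R" using w by simp
  note par = parent[OF nr]
  have fin: "finite S" using S by (simp add: before_def)
  have "(\<exists>u\<in>S. adj parent_edges u w) \<longleftrightarrow> p w \<in> S"
  proof
    assume "\<exists>u\<in>S. adj parent_edges u w"
    then obtain u where u: "u \<in> S" "w = p u \<and> u \<in> verts G - R \<or> u = p w"
      by (auto simp: adj_parent_edges)
    moreover have "\<not> (w = p u \<and> u \<in> verts G - R)" 
      using parent[of u] u(1) assms by (auto simp: before_def)
    ultimately show "p w \<in> S" by auto
  qed (use nr in \<open>auto simp: adj_parent_edges\<close>)
  also have "\<dots> \<longleftrightarrow> c w + joins G w (before pos (verts G) (p w)) < joins G w S"
  proof
    assume "p w \<in> S"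
    moreover from this have "before pos (verts G) (p w) \<subseteq> S" using S by (auto simp: before_def)
    ultimately show "c w + joins G w (before pos (verts G) (p w)) < joins G w S"
      using joins_before_le[OF _ _ fin, of "p w" pos G w] par by linarith
  next
    assume less: "c w + joins G w (before pos (verts G) (p w)) < joins G w S"
    show "p w \<in> S"
    proof (rule ccontr)
      assume "p w \<notin> S"
      then have "S \<subseteq> before pos (verts G) (p w)" using S par by (auto simp: before_def)
      then have "joins G w S \<le> joins G w (before pos (verts G) (p w))"
        by (intro joins_mono) (auto simp: before_def)
      then show False using less by simp
    qed
  qed
  finally show ?thesis using nr by (simp add: parking_fun_def) linarith
qed

text \<open>
  Only the earliest vertex \<open>v\<close> of \<open>I\<close> matters. If it is a root, it is the least vertex \<open>\<ge> m\<close> among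
  those not preceding it, and so equals \<open>alpha I m\<close>. Otherwise its parent and everything before the
  parent lie outside \<open>I\<close>, so all the edges counted in its value, and its parent edge, leave \<open>I\<close>.
\<close>

lemma parking_fun_multiparking: "parking_fun \<in> multiparking G m"
proof -
  have "(\<exists>i\<in>I. m \<le> i) \<and> parking_fun (alpha I m) = -1 \<or>
      (\<exists>i\<in>I. 0 \<le> parking_fun i \<and> parking_fun i < int (outdeg G I i))"
    if I: "I \<subseteq> verts G" "I \<noteq> {}" for I
  proof -
    have finI: "finite I" using I(1) finite_subset finite_verts by blast
    define v where "v = arg_min_on pos I"
    have v: "v \<in> I" "\<And>u. u \<in> I \<Longrightarrow> pos v \<le> pos u"
      unfolding v_def using finI I(2) by (simp_all add: arg_min_if_finite(1) arg_min_least)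
    show ?thesis
    proof (cases "v \<in> R")
      case True
      then have "alpha I m = v"
        using v I(1) root_least[OF True] finI by (intro alpha_eqI) auto
      then show ?thesis using True v(1) root_least[OF True] I(1) by (auto simp: parking_fun_def)
    next
      case False
      then have nr: "v \<in> verts G - R" using v(1) I(1) by auto
      have "p v \<in> verts G - I" using parent[OF nr] v(2)[of "p v"] by auto
      moreover have "before pos (verts G) (p v) \<subseteq> verts G - I"
        using parent[OF nr] v(2) by (fastforce simp: before_def)
      ultimately have "joins G v (before pos (verts G) (p v)) + mult G {v, p v} \<le> outdeg G I v"
        using joins_before_le[of "p v" "verts G - I" pos G v] by (simp add: joins_def outdeg_def)
      then have "0 \<le> parking_fun v \<and> parking_fun v < int (outdeg G I v)"
        using parent[OF nr] nr by (simp add: parking_fun_def)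
      then show ?thesis using v(1) by blast
    qed
  qed
  then show ?thesis by (auto simp: multiparking_def parking_fun_def)
qed

end

section \<open>Every forest is given by parents\<close>

lemma simple_path:
  assumes "P\<^sup>*\<^sup>* a b"
  shows "\<exists>vs. vs \<noteq> [] \<and> hd vs = a \<and> last vs = b \<and> distinct vs \<and> successively P vs"
  using assms
proof (induction rule: rtranclp_induct)
  case base
  show ?case by (intro exI[of _ "[a]"]) simp
next
  case (step y z)
  then obtain vs where vs: "vs \<noteq> []" "hd vs = a" "last vs = y" "distinct vs" "successively P vs"
    by blast
  show ?case
  proof (cases "z \<in> set vs")
    case True
    then obtain xs ys where "vs = xs @ z # ys" by (meson split_list)
    then show ?thesis using vs
      by (intro exI[of _ "xs @ [z]"]) (auto simp: successively_append_iff hd_append)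
  next
    case False
    then show ?thesis using vs step.hyps(2)
      by (intro exI[of _ "vs @ [z]"]) (auto simp: successively_append_iff)
  qed
qed

lemma adj_rtranclp_mono:
  assumes "F \<subseteq> F'" "(adj F)\<^sup>*\<^sup>* x y"
  shows "(adj F')\<^sup>*\<^sup>* x y"
proof -
  have "adj F \<le> adj F'" unfolding le_fun_def le_bool_def adj_def using assms(1) by blast
  then show ?thesis using rtranclp_mono assms(2) by blast
qed

text \<open>
  If the ends of an edge stay connected without it, a simple path between them is closed to a cycle
  by the edge. Loops and parallel edges give paths with one and
  two vertices.
\<close>

lemma cycle_through_edge:
  assumes e: "({a, b}, k) \<in> F" and conn: "(adj (F - {({a, b}, k)}))\<^sup>*\<^sup>* a b"
  shows "\<exists>vs es. is_cycle F vs es"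
proof -
  let ?e = "({a, b}, k)"
  obtain vs where vs: "vs \<noteq> []" "hd vs = a" "last vs = b" "distinct vs"
    "successively (adj (F - {?e})) vs"
    using simple_path[OF conn] by blast
  define L where "L = length vs"
  have L: "L > 0" using vs(1) by (simp add: L_def)
  have "\<exists>d\<in>F - {?e}. fst d = {vs ! i, vs ! Suc i}" if "Suc i < L" for i
  proof -
    obtain l where "({vs ! i, vs ! Suc i}, l) \<in> F - {?e}"
      using vs(5) \<open>Suc i < L\<close> unfolding successively_conv_nth adj_def L_def by blast
    then show ?thesis by (metis fst_conv)
  qed
  then obtain g where g: "\<And>i. Suc i < L \<Longrightarrow> g i \<in> F - {?e} \<and> fst (g i) = {vs ! i, vs ! Suc i}"
    by metis
  (* The last edge of the list closes the path. *)
  define es where "es = map (\<lambda>i. if Suc i < L then g i else ?e) [0..<L]"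
  have nth: "es ! i = (if Suc i < L then g i else ?e)" if "i < L" for i
    using that by (simp add: es_def)
  have inj: "i = j" if ij: "i < L" "j < L" "es ! i = es ! j" for i j
  proof -
    consider "Suc i < L" "Suc j < L" | "Suc i < L" "\<not> Suc j < L" | "\<not> Suc i < L" "Suc j < L"
      | "\<not> Suc i < L" "\<not> Suc j < L" by blast
    then show ?thesis
    proof cases
      case 1
      then have "{vs ! i, vs ! Suc i} = {vs ! j, vs ! Suc j}" using nth ij g by metis
      then show ?thesis using 1 ij vs(4)
        by (auto simp: doubleton_eq_iff nth_eq_iff_index_eq L_def)
    next
      case 2
      then show ?thesis using nth ij g[of i] by auto
    next
      case 3
      then show ?thesis using nth ij g[of j] by auto
    next
      case 4
      then show ?thesis using ij by linarith
    qed
  qed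
  have len: "length es = L" by (simp add: es_def)
  have "distinct es" unfolding distinct_conv_nth len using inj by blast
  moreover have "set es \<subseteq> F" using g e by (auto simp: es_def)
  moreover have "fst (es ! i) = {vs ! i, vs ! (Suc i mod L)}" if i: "i < L" for i
  proof (cases "Suc i < L")
    case True
    then show ?thesis using nth[OF i] g by simp
  next
    case False
    then have "Suc i = L" using i by simp
    then have "i = L - 1" "Suc i mod L = 0" by auto
    then show ?thesis using nth[OF i] False vs(1-3)
      by (auto simp: hd_conv_nth last_conv_nth L_def insert_commute)
  qed
  ultimately have "is_cycle F vs es"
    using L vs(4) by (auto simp: is_cycle_def es_def L_def)
  then show ?thesis by blast
qed

text \<open>
  Take as roots the vertices that were chosen on an empty frontier, and hang every other vertex on
  an arbitrary earlier neighbor. The resulting parent edges already connect any two vertices in the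
  same component of \<open>F\<close>, because distinct roots lie in distinct components of \<open>F\<close>. A further edge of
  \<open>F\<close> would then close a cycle, so the arbitrary choices were forced.
\<close>

lemma forest_parents:
  assumes m: "m \<in> verts G" and F: "F \<in> forests G m"
  shows "\<exists>R p c. parent_forest G m (position G m \<tau> F) R p c \<and>
    F = parent_forest.parent_edges G R p c \<and>
    forest_fun G m \<tau> F = parent_forest.parking_fun G (position G m \<tau> F) R p c"
proof -
  define pos where "pos = position G m \<tau> F"
  let ?N = "next_vertex G m \<tau> F"
  let ?B = "before pos (verts G)"
  have rank: "pos = rank ?N (verts G)" unfolding pos_def by (rule position_eq_rank[OF m])
  have inj: "inj_on pos (verts G)"
    unfolding rank by (rule inj_on_rank) (simp_all add: next_vertex_new[OF F] del: Diff_iff)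
  have step: "?N (?B v) = v" if "v \<in> verts G" for v
    unfolding rank using that
    by (intro rank_step) (simp_all add: next_vertex_new[OF F] del: Diff_iff)
  have sub: "F \<subseteq> edges G" using F by (simp add: forests_def)
  define R where "R = {v \<in> verts G. forest_frontier G F (?B v) = {}}"
  have "\<exists>u k. u \<in> ?B v \<and> ({v, u}, k) \<in> F" if "v \<in> verts G - R" for v
  proof -
    have ne: "forest_frontier G F (?B v) \<noteq> {}" using that by (simp add: R_def)
    then have "?N (?B v) \<in> forest_frontier G F (?B v)"
      using arg_min_frontier[OF ne] by (simp add: next_vertex_frontier)
    then have "v \<in> forest_frontier G F (?B v)" using step that by simp
    then show ?thesis by (auto simp: forest_frontier_def adj_def insert_commute)
  qed
  then obtain p c where pc: "\<And>v. v \<in> verts G - R \<Longrightarrow> p v \<in> ?B v \<and> ({v, p v}, c v) \<in> F"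
    by metis
  have closed: "y \<in> verts G - ?B r" 
    if r: "r \<in> R" and x: "x \<in> verts G - ?B r" and xy: "adj F x y" for r x y
  proof -
    obtain k where "({x, y}, k) \<in> F" using xy by (auto simp: adj_def)
    then have "y \<in> verts G" using edge_verts(2)[OF sub] by blast
    moreover have "forest_frontier G F (?B r) = {}" using r by (simp add: R_def)
    ultimately show ?thesis using x adj_sym[OF xy]
      unfolding forest_frontier_def by blast
  qed
  interpret parent_forest G m pos R p c
  proof
    show "inj_on pos (verts G)" by (rule inj)
    show "R \<subseteq> verts G" by (auto simp: R_def)
    show "p v \<in> verts G \<and> pos (p v) < pos v \<and> c v < mult G {v, p v}" if "v \<in> verts G - R" for v
      using pc[OF that] edge_verts[OF sub] by (auto simp: before_def)
    show "m \<le> r \<and> (\<forall>u\<in>verts G. m \<le> u \<longrightarrow> pos r \<le> pos u \<longrightarrow> r \<le> u)" if r: "r \<in> R" for r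
    proof -
      have e: "forest_frontier G F (?B r) = {}" and rV: "r \<in> verts G" using r by (auto simp: R_def)
      have "?B r \<subset> verts G" using rV by (auto simp: before_def)
      then have "\<exists>u\<in>verts G - ?B r. m \<le> u" using large_vertex_outside[OF F _ e] by blast
      moreover have "alpha (verts G - ?B r) m = r" 
        using step[OF rV] e by (simp add: next_vertex_frontier)
      ultimately show ?thesis
        using alpha_least[of "verts G - ?B r" m] by (auto simp: before_def)
    qed
    show "pos r \<le> pos (p v)" if "r \<in> R" "v \<in> verts G - R" "pos r \<le> pos v" for r v
    proof -
      have "adj F v (p v)" using pc[OF that(2)] by (auto simp: adj_def)
      then show ?thesis using closed[OF that(1), of v "p v"] that by (auto simp: before_def)
    qed
  qed
  have incl: "parent_edges \<subseteq> F" using pc by (auto simp: parent_edges_def)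
  have "F \<subseteq> parent_edges"
  proof
    fix e assume e: "e \<in> F"
    show "e \<in> parent_edges"
    proof (rule ccontr)
      assume ne: "e \<notin> parent_edges"
      obtain a b k where ab: "e = ({a, b}, k)" "a \<in> verts G" "b \<in> verts G"
        using e sub by (auto simp: edges_def)
      obtain ra rb where ra: "ra \<in> R" "(adj parent_edges)\<^sup>*\<^sup>* a ra"
        and rb: "rb \<in> R" "(adj parent_edges)\<^sup>*\<^sup>* b rb"
        using reaches_root ab(2,3) by blast
      have up: "(adj F)\<^sup>*\<^sup>* x y" if "(adj parent_edges)\<^sup>*\<^sup>* x y" for x y
        using incl that by (rule adj_rtranclp_mono)
      (* Two roots in one component of F would each be no later than the other. *)
      have later: "pos r \<le> pos u" if "r \<in> R" "(adj F)\<^sup>*\<^sup>* r u" for r u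
      proof -
        have "u \<in> verts G - ?B r"
        proof (rule adj_closed[OF that(2)])
          show "r \<in> verts G - ?B r" using that(1) by (auto simp: before_def R_def)
          show "y \<in> verts G - ?B r" if "x \<in> verts G - ?B r" "adj F x y" for x y
            using closed[OF \<open>r \<in> R\<close> that] .
        qed
        then show ?thesis by (auto simp: before_def)
      qed
      have "adj F a b" using e ab(1) by (auto simp: adj_def)
      then have "(adj F)\<^sup>*\<^sup>* ra rb"
        using adj_rtranclp_sym[OF up[OF ra(2)]] up[OF rb(2)]
        by (meson rtranclp.rtrancl_into_rtrancl rtranclp_trans)
      then have "pos ra = pos rb"
        using later[OF ra(1)] later[OF rb(1)] adj_rtranclp_sym by (meson le_antisym)
      then have "ra = rb" using inj_onD[OF inj] ra(1) rb(1) roots by blast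
      then have "(adj parent_edges)\<^sup>*\<^sup>* a b"
        using ra(2) adj_rtranclp_sym[OF rb(2)] by (simp add: rtranclp_trans)
      then have "(adj (F - {e}))\<^sup>*\<^sup>* a b"
        using incl ne by (intro adj_rtranclp_mono[of parent_edges "F - {e}"]) auto
      then show False using cycle_through_edge e F unfolding ab(1) forests_def by blast
    qed
  qed
  then have F_eq: "F = parent_edges" using incl by blast
  have "forest_fun G m \<tau> F = parking_fun"
    using forest_fun_parking_fun[of \<tau>] unfolding F_eq[symmetric] pos_def by simp
  then show ?thesis using F_eq parent_forest_axioms unfolding pos_def by blast
qed

section \<open>Forests and multiparking functions\<close>

definition parking_frontier :: "multigraph \<Rightarrow> (nat \<Rightarrow> int) \<Rightarrow> nat set \<Rightarrow> nat set" where
  "parking_frontier G f S = {w \<in> verts G - S. 0 \<le> f w \<and> f w < int (joins G w S)}"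

definition next_parking ::
    "multigraph \<Rightarrow> nat \<Rightarrow> (nat \<Rightarrow> nat) \<Rightarrow> (nat \<Rightarrow> int) \<Rightarrow> nat set \<Rightarrow> nat" where
  "next_parking G m \<tau> f S = (if parking_frontier G f S = {} then alpha (verts G - S) m
     else arg_min_on \<tau> (parking_frontier G f S))"

lemma (in parent_forest) next_vertex_parking:
  "next_vertex G m \<tau> parent_edges (before pos (verts G) v) =
   next_parking G m \<tau> parking_fun (before pos (verts G) v)"
proof -
  let ?S = "before pos (verts G) v"
  have "forest_frontier G parent_edges ?S = parking_frontier G parking_fun ?S"
    using parking_fun_frontier[OF _ refl] 
    unfolding forest_frontier_def parking_frontier_def by blast
  then show ?thesis by (simp add: next_vertex_frontier next_parking_def)
qed

text \<open>
  For fixed \<open>v\<close>, the numbers \<open>k + joins G v (before pos (verts G) u)\<close> with \<open>k < mult G {v, u}\<close> number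
  the edges at \<open>v\<close> by the position of \<open>u\<close> and then by color. So the value of the function at \<open>v\<close>
  determines both the parent of \<open>v\<close> and the color of the parent edge.
\<close>

lemma joins_decode_unique:
  assumes inj: "inj_on pos (verts G)" and u: "u \<in> verts G" "u' \<in> verts G"
    and k: "k < mult G {v, u}" "k' < mult G {v, u'}"
    and eq: "k + joins G v (before pos (verts G) u) = k' + joins G v (before pos (verts G) u')"
  shows "u = u' \<and> k = k'"
proof -
  have le: "joins G v (before pos (verts G) x) + mult G {v, x} \<le> joins G v (before pos (verts G) y)"
    if "pos x < pos y" "x \<in> verts G" for x y
    using that by (intro joins_before_le) (auto simp: before_def)
  consider "pos u < pos u'" | "pos u' < pos u" | "pos u = pos u'" by linarith
  then show ?thesis
  proof cases
    case 1
    then show ?thesis using le[OF 1 u(1)] k eq by linarith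
  next
    case 2
    then show ?thesis using le[OF 2 u(2)] k eq by linarith
  next
    case 3
    then show ?thesis using inj_onD[OF inj 3 u] eq by simp
  qed
qed

lemma joins_decode:
  assumes "inj_on pos (verts G)" "n < joins G w (before pos (verts G) v)"
  shows "\<exists>u k. u \<in> before pos (verts G) v \<and> k < mult G {w, u} \<and>
    n = k + joins G w (before pos (verts G) u)"
  using assms(2)
proof (induction "pos v" arbitrary: v rule: less_induct)
  case less
  let ?B = "before pos (verts G)"
  have fin: "finite (?B v)" by (simp add: before_def)
  have "?B v \<noteq> {}" using less.prems by (auto simp: joins_def)
  then have "Max (pos ` ?B v) \<in> pos ` ?B v" using fin by (intro Max_in) auto
  then obtain u where u: "u \<in> ?B v" "pos u = Max (pos ` ?B v)" by auto
  have top: "pos x \<le> pos u" if "x \<in> ?B v" for x unfolding u(2) using that fin by (intro Max_ge) auto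
  (* u is the immediate predecessor of v in the order. *)
  have split: "?B v = insert u (?B u)"
  proof (intro equalityI subsetI)
    fix x assume x: "x \<in> ?B v"
    show "x \<in> insert u (?B u)"
    proof (cases "x = u")
      case False
      then have "pos x \<noteq> pos u" using inj_onD[OF assms(1)] x u(1) by (auto simp: before_def)
      then show ?thesis using top[OF x] x by (auto simp: before_def)
    qed simp
  qed (use u(1) in \<open>auto simp: before_def\<close>)
  have "u \<notin> ?B u" "finite (?B u)" by (auto simp: before_def)
  then have sum: "joins G w (?B v) = mult G {w, u} + joins G w (?B u)"
    unfolding split by (simp add: joins_def)
  show ?case
  proof (cases "n < joins G w (?B u)")
    case True
    have "pos u < pos v" using u(1) by (simp add: before_def)
    then show ?thesis using less.hyps[OF _ True] split by auto
  next
    case False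
    then show ?thesis using u(1) sum less.prems
      by (intro exI[of _ u] exI[of _ "n - joins G w (?B u)"]) auto
  qed
qed

lemma (in parent_forest) parent_edges_decoded:
  "parent_edges = {({v, u}, k) | v u k. v \<in> verts G \<and> u \<in> verts G \<and> k < mult G {v, u} \<and>
     parking_fun v = int (k + joins G v (before pos (verts G) u))}" (is "_ = ?D")
proof (intro equalityI subsetI)
  fix e assume "e \<in> parent_edges"
  then obtain v where "v \<in> verts G - R" "e = ({v, p v}, c v)" by (auto simp: parent_edges_def)
  then show "e \<in> ?D" using parent[of v] by (auto simp: parking_fun_def)
next
  fix e assume "e \<in> ?D"
  then obtain v u k where e: "e = ({v, u}, k)" and v: "v \<in> verts G" and u: "u \<in> verts G"
    "k < mult G {v, u}" "parking_fun v = int (k + joins G v (before pos (verts G) u))" by blast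
  have nr: "v \<in> verts G - R" using v u(3) by (auto simp: parking_fun_def)
  then have "k + joins G v (before pos (verts G) u) = c v + joins G v (before pos (verts G) (p v))"
    using u(3) by (simp add: parking_fun_def)
  then have "u = p v \<and> k = c v"
    using joins_decode_unique[OF inj_pos u(1) _ u(2)] parent[OF nr] by blast
  then show "e \<in> parent_edges" using nr e by (auto simp: parent_edges_def)
qed

lemma position_from_forest_fun:
  assumes m: "m \<in> verts G" and F: "F \<in> forests G m"
  shows "position G m \<tau> F = rank (next_parking G m \<tau> (forest_fun G m \<tau> F)) (verts G)"
proof -
  let ?pos = "position G m \<tau> F"
  obtain R p c where "parent_forest G m ?pos R p c" 
    and F_eq: "F = parent_forest.parent_edges G R p c"
    and f: "forest_fun G m \<tau> F = parent_forest.parking_fun G (position G m \<tau> F) R p c"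
    using forest_parents[OF m F] by blast
  then interpret parent_forest G m ?pos R p c by simp
  have rank: "?pos = rank (next_vertex G m \<tau> F) (verts G)" by (rule position_eq_rank[OF m])
  have "rank (next_parking G m \<tau> (forest_fun G m \<tau> F)) (verts G)
      = rank (next_vertex G m \<tau> F) (verts G)"
  proof (rule rank_cong)
    show "next_parking G m \<tau> (forest_fun G m \<tau> F)
        (before (rank (next_vertex G m \<tau> F) (verts G)) (verts G) v)
      = next_vertex G m \<tau> F (before (rank (next_vertex G m \<tau> F) (verts G)) (verts G) v)" for v
      using next_vertex_parking[of \<tau> v] unfolding f rank[symmetric] F_eq[symmetric] by simp
  qed (simp_all add: next_vertex_new[OF F] del: Diff_iff)
  then show ?thesis using rank by simp
qed

text \<open>
  The function determines the order, and order and function determine the edges.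
\<close>

lemma inj_on_forest_fun:
  assumes m: "m \<in> verts G"
  shows "inj_on (forest_fun G m \<tau>) (forests G m)"
proof (rule inj_onI)
  fix F F' assume F: "F \<in> forests G m" "F' \<in> forests G m"
    and eq: "forest_fun G m \<tau> F = forest_fun G m \<tau> F'"
  have decoded: "H = {({v, u}, k) | v u k. v \<in> verts G \<and> u \<in> verts G \<and> k < mult G {v, u} \<and>
      forest_fun G m \<tau> H v = int (k + joins G v (before (position G m \<tau> H) (verts G) u))}"
    if H: "H \<in> forests G m" for H
  proof -
    obtain R p c where "parent_forest G m (position G m \<tau> H) R p c"
      and H_eq: "H = parent_forest.parent_edges G R p c"
      and f: "forest_fun G m \<tau> H = parent_forest.parking_fun G (position G m \<tau> H) R p c"
      using forest_parents[OF m H] by blast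
    then interpret parent_forest G m "position G m \<tau> H" R p c by simp
    show ?thesis unfolding f using parent_edges_decoded H_eq by simp
  qed
  have "position G m \<tau> F = position G m \<tau> F'" using position_from_forest_fun[OF m] F eq by simp
  then show "F = F'" using decoded[OF F(1)] decoded[OF F(2)] eq by simp
qed

lemma forest_fun_multiparking:
  assumes m: "m \<in> verts G" and F: "F \<in> forests G m"
  shows "forest_fun G m \<tau> F \<in> multiparking G m"
proof -
  obtain R p c where "parent_forest G m (position G m \<tau> F) R p c"
    and F_eq: "F = parent_forest.parent_edges G R p c"
    and f: "forest_fun G m \<tau> F = parent_forest.parking_fun G (position G m \<tau> F) R p c"
    using forest_parents[OF m F] by blast
  then interpret parent_forest G m "position G m \<tau> F" R p c by simp
  show ?thesis unfolding f by (rule parking_fun_multiparking)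
qed

text \<open>
  The multiparking condition for the complement of \<open>S\<close>: an empty frontier rules out the second
  alternative, because edges leaving the complement are edges into \<open>S\<close>.
\<close>

lemma parking_blocked:
  assumes f: "f \<in> multiparking G m" and S: "S \<subset> verts G" and blocked: "parking_frontier G f S = {}"
  shows "(\<exists>i\<in>verts G - S. m \<le> i) \<and> f (alpha (verts G - S) m) = -1"
proof -
  have "outdeg G (verts G - S) i = joins G i S" for i
  proof -
    have "verts G - (verts G - S) = S" using S by auto
    then show ?thesis by (simp add: outdeg_def joins_def)
  qed
  then have "\<not> (\<exists>i\<in>verts G - S. 0 \<le> f i \<and> f i < int (outdeg G (verts G - S) i))"
    using blocked by (auto simp: parking_frontier_def)
  moreover have "verts G - S \<subseteq> verts G" "verts G - S \<noteq> {}" using S by auto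
  ultimately show ?thesis using f unfolding multiparking_def by blast
qed

lemma arg_min_parking_frontier:
  fixes \<tau> :: "nat \<Rightarrow> nat"
  assumes "parking_frontier G f S \<noteq> {}"
  shows "arg_min_on \<tau> (parking_frontier G f S) \<in> parking_frontier G f S"
proof -
  have "finite (parking_frontier G f S)" by (simp add: parking_frontier_def)
  then show ?thesis using arg_min_if_finite(1)[of _ \<tau>] assms by blast
qed

lemma next_parking_new:
  assumes f: "f \<in> multiparking G m" and S: "S \<subset> verts G"
  shows "next_parking G m \<tau> f S \<in> verts G - S"
proof (cases "parking_frontier G f S = {}")
  case True
  then show ?thesis
    using parking_blocked[OF f S True] alpha_least[of "verts G - S" m]
    by (auto simp: next_parking_def)
next
  case False
  then show ?thesis using arg_min_parking_frontier[OF False]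
    by (auto simp: next_parking_def parking_frontier_def)
qed

text \<open>
  The forest is found by searching with \<open>next_parking\<close>. A vertex is chosen on an empty frontier
  exactly if its value is \<open>-1\<close>; every other vertex \<open>v\<close> is chosen from the frontier, so that its value
  numbers an edge from \<open>v\<close> to an earlier vertex, which becomes the parent edge.
\<close>

lemma multiparking_is_forest_fun:
  assumes m: "m \<in> verts G" and f: "f \<in> multiparking G m"
  shows "\<exists>F\<in>forests G m. forest_fun G m \<tau> F = f"
proof -
  let ?N = "next_parking G m \<tau> f"
  define pos where "pos = rank ?N (verts G)"
  let ?B = "before pos (verts G)"
  have inj: "inj_on pos (verts G)"
    unfolding pos_def by (rule inj_on_rank) (simp_all add: next_parking_new[OF f] del: Diff_iff)
  have step: "?N (?B v) = v" if "v \<in> verts G" for v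
    unfolding pos_def using that
    by (intro rank_step) (simp_all add: next_parking_new[OF f] del: Diff_iff)
  have range: "-1 \<le> f v" if "v \<in> verts G" for v
    using f that by (auto simp: multiparking_def PiE_def Pi_def)
  define R where "R = {v \<in> verts G. f v = -1}"
  have proper: "?B v \<subset> verts G" if "v \<in> verts G" for v using that by (auto simp: before_def)
  have root_blocked: "v \<in> R \<longleftrightarrow> parking_frontier G f (?B v) = {}" if v: "v \<in> verts G" for v
  proof (cases "parking_frontier G f (?B v) = {}")
    case True
    then have "alpha (verts G - ?B v) m = v" using step[OF v] by (simp add: next_parking_def)
    then show ?thesis using parking_blocked[OF f proper[OF v] True] True v by (simp add: R_def)
  next
    case False
    then have "v \<in> parking_frontier G f (?B v)"
      using arg_min_parking_frontier[OF False, of \<tau>] step[OF v] by (simp add: next_parking_def)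
    then show ?thesis using False by (auto simp: R_def parking_frontier_def)
  qed
  have "\<exists>u k. u \<in> ?B v \<and> k < mult G {v, u} \<and> f v = int (k + joins G v (?B u))"
    if v: "v \<in> verts G - R" for v
  proof -
    have ne: "parking_frontier G f (?B v) \<noteq> {}" using root_blocked v by auto
    then have "v \<in> parking_frontier G f (?B v)"
      using arg_min_parking_frontier[OF ne, of \<tau>] step[of v] v by (simp add: next_parking_def)
    then have "0 \<le> f v" "nat (f v) < joins G v (?B v)" by (auto simp: parking_frontier_def)
    then show ?thesis using joins_decode[OF inj, of "nat (f v)" v v] by force
  qed
  then obtain p c where pc: "\<And>v. v \<in> verts G - R \<Longrightarrow>
      p v \<in> ?B v \<and> c v < mult G {v, p v} \<and> f v = int (c v + joins G v (?B (p v)))"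
    by metis
  interpret parent_forest G m pos R p c
  proof
    show "inj_on pos (verts G)" by (rule inj)
    show "R \<subseteq> verts G" by (auto simp: R_def)
    show "p v \<in> verts G \<and> pos (p v) < pos v \<and> c v < mult G {v, p v}" if "v \<in> verts G - R" for v
      using pc[OF that] by (auto simp: before_def)
    show "m \<le> r \<and> (\<forall>u\<in>verts G. m \<le> u \<longrightarrow> pos r \<le> pos u \<longrightarrow> r \<le> u)" if r: "r \<in> R" for r
    proof -
      have rV: "r \<in> verts G" using r by (simp add: R_def)
      then have blocked: "parking_frontier G f (?B r) = {}" using root_blocked r by simp
      have "alpha (verts G - ?B r) m = r"
        using step[OF rV] blocked by (simp add: next_parking_def)
      then show ?thesis
        using parking_blocked[OF f proper[OF rV] blocked] alpha_least[of "verts G - ?B r" m]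
        by (auto simp: before_def)
    qed
    show "pos r \<le> pos (p v)" if rv: "r \<in> R" "v \<in> verts G - R" "pos r \<le> pos v" for r v
    proof (rule ccontr)
      assume "\<not> pos r \<le> pos (p v)"
      then have "p v \<in> ?B r" "?B (p v) \<subseteq> ?B r" using pc[OF rv(2)] by (auto simp: before_def)
      then have "joins G v (?B (p v)) + mult G {v, p v} \<le> joins G v (?B r)"
        by (intro joins_before_le) (auto simp: before_def)
      then have "0 \<le> f v \<and> f v < int (joins G v (?B r))" using pc[OF rv(2)] by simp
      then have "v \<in> parking_frontier G f (?B r)"
        using rv by (auto simp: parking_frontier_def before_def)
      then show False using root_blocked[of r] rv(1) by (auto simp: R_def)
    qed
  qed
  have fun_eq: "parking_fun = f"
  proof
    fix v
    have "f v = undefined" if "v \<notin> verts G"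
      using f that by (auto simp: multiparking_def PiE_def extensional_def)
    moreover have "parking_fun v = f v" if "v \<in> verts G - R"
      using pc[OF that] that by (simp add: parking_fun_def)
    moreover have "f v = -1" if "v \<in> R" using that by (simp add: R_def)
    ultimately show "parking_fun v = f v"
      by (cases "v \<in> verts G"; cases "v \<in> R") (simp_all add: parking_fun_def)
  qed
  have "rank (next_vertex G m \<tau> parent_edges) (verts G) = rank ?N (verts G)"
  proof (rule rank_cong)
    show "next_vertex G m \<tau> parent_edges (before (rank ?N (verts G)) (verts G) v)
        = ?N (before (rank ?N (verts G)) (verts G) v)" for v
      using next_vertex_parking[of \<tau> v, unfolded fun_eq] unfolding pos_def .
  qed (simp_all add: next_parking_new[OF f] del: Diff_iff)
  then have "position G m \<tau> parent_edges = pos" by (simp add: position_eq_rank[OF m] pos_def)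
  then have "forest_fun G m \<tau> parent_edges = f"
    using forest_fun_parking_fun[of \<tau>] fun_eq by simp
  then show ?thesis using parent_edges_forest by blast
qed

lemma bij_betw_forest_fun:
  assumes "m \<in> verts G"
  shows "bij_betw (forest_fun G m \<tau>) (forests G m) (multiparking G m)"
  unfolding bij_betw_def
proof (intro conjI equalityI subsetI)
  show "inj_on (forest_fun G m \<tau>) (forests G m)" by (rule inj_on_forest_fun[OF assms])
next
  fix f assume "f \<in> multiparking G m"
  then show "f \<in> forest_fun G m \<tau> ` forests G m"
    using multiparking_is_forest_fun[OF assms, of f \<tau>] by blast
qed (use forest_fun_multiparking[OF assms] in auto)

section \<open>Counting redundant edges\<close>

lemma verts_delete_edge [simp]: "verts (delete_edge G e) = verts G"
  by (simp add: delete_edge_def verts_def)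

lemma mult_delete_edge:
  "mult (delete_edge G e) X = (if X = fst e then mult G X - 1 else mult G X)"
  by (simp add: delete_edge_def)

lemma joins_delete_edge:
  assumes "finite S" "mult G (fst e) > 0"
  shows "joins (delete_edge G e) v S \<le> joins G v S"
    and "joins (delete_edge G e) v S = joins G v S \<longleftrightarrow> \<not> (\<exists>u\<in>S. fst e = {v, u})"
proof -
  show le: "joins (delete_edge G e) v S \<le> joins G v S"
    unfolding joins_def by (intro sum_mono) (simp add: mult_delete_edge)
  show "joins (delete_edge G e) v S = joins G v S \<longleftrightarrow> \<not> (\<exists>u\<in>S. fst e = {v, u})"
  proof
    assume eq: "joins (delete_edge G e) v S = joins G v S"
    show "\<not> (\<exists>u\<in>S. fst e = {v, u})"
    proof
      assume "\<exists>u\<in>S. fst e = {v, u}"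
      then obtain u where u: "u \<in> S" "fst e = {v, u}" by blast
      have "joins (delete_edge G e) v S < joins G v S"
        unfolding joins_def
        using u assms by (intro sum_strict_mono_ex1) (auto simp: mult_delete_edge intro!: bexI[of _ u])
      then show False using eq by simp
    qed
  next
    assume "\<not> (\<exists>u\<in>S. fst e = {v, u})"
    then show "joins (delete_edge G e) v S = joins G v S"
      unfolding joins_def by (intro sum.cong) (auto simp: mult_delete_edge)
  qed
qed

context parent_forest
begin

text \<open>
  The edges at a non-root \<open>v\<close> that precede its parent edge when the edges at \<open>v\<close> are listed by the
  position of their other end and then by color.
\<close>

definition counted_edges :: "nat \<Rightarrow> edge set" where
  "counted_edges v = {({v, u}, k) | u k. u \<in> before pos (verts G) (p v) \<and> k < mult G {v, u}} \<union>
     {({v, p v}, k) | k. k < c v}"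

lemma counted_edges_other_end:
  assumes "v \<in> verts G - R" "e \<in> counted_edges v"
  shows "\<exists>u\<in>verts G. fst e = {v, u} \<and> pos u < pos v"
  using assms parent[OF assms(1)] by (auto simp: counted_edges_def before_def)

lemma card_counted_edges:
  assumes v: "v \<in> verts G - R"
  shows "finite (counted_edges v) \<and>
    card (counted_edges v) = c v + joins G v (before pos (verts G) (p v))"
proof -
  let ?B = "before pos (verts G) (p v)"
  let ?A = "Sigma ?B (\<lambda>u. {..<mult G {v, u}})"
  let ?g = "\<lambda>(u, k). ({v, u}, k)"
  have eq: "counted_edges v = ?g ` ?A \<union> Pair {v, p v} ` {..<c v}"
    by (auto simp: counted_edges_def image_iff)
  have finB: "finite ?B" by (simp add: before_def)
  have "inj_on ?g ?A" by (auto simp: inj_on_def doubleton_eq_iff)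
  then have 1: "card (?g ` ?A) = joins G v ?B" using finB by (simp add: card_image joins_def)
  have 2: "card (Pair {v, p v} ` {..<c v}) = c v" by (subst card_image) (auto simp: inj_on_def)
  have "?g ` ?A \<inter> Pair {v, p v} ` {..<c v} = {}"
    by (auto simp: before_def doubleton_eq_iff)
  then show ?thesis using finB 1 2 by (simp add: eq card_Un_disjoint)
qed

lemma counted_edges_subset:
  assumes v: "v \<in> verts G - R"
  shows "counted_edges v \<subseteq> edges G - parent_edges"
proof
  fix e assume e: "e \<in> counted_edges v"
  have "e \<in> edges G"
    using e v parent[OF v] by (auto simp: counted_edges_def before_def intro!: edgeI)
  moreover have "e \<notin> parent_edges"
  proof
    assume pe: "e \<in> parent_edges"
    obtain u where u: "fst e = {v, u}" "pos u < pos v" using counted_edges_other_end[OF v e] by blast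
    then have "e = ({v, p v}, c v)" using parent_edge_later_endpoint[OF pe] by simp
    then show False using e by (auto simp: counted_edges_def before_def doubleton_eq_iff)
  qed
  ultimately show "e \<in> edges G - parent_edges" by simp
qed

lemma counted_edges_disjoint:
  assumes "v \<in> verts G - R" "w \<in> verts G - R" "v \<noteq> w"
  shows "counted_edges v \<inter> counted_edges w = {}"
proof -
  have False if "e \<in> counted_edges v" "e \<in> counted_edges w" for e
    using counted_edges_other_end[OF assms(1) that(1)] counted_edges_other_end[OF assms(2) that(2)]
      assms(3) by (auto simp: doubleton_eq_iff)
  then show ?thesis by blast
qed

lemma card_parent_edges: "card parent_edges = card (verts G - R)"
  unfolding parent_edges_def
proof (rule card_image, rule inj_onI)
  fix v w assume vw: "v \<in> verts G - R" "w \<in> verts G - R" "({v, p v}, c v) = ({w, p w}, c w)"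
  then show "v = w" using parent[OF vw(1)] parent[OF vw(2)] by (auto simp: doubleton_eq_iff)
qed

text \<open>
  Deleting \<open>e\<close> and recoloring leaves the order, the roots and the parents in place, so the locale
  can be instantiated a second time for \<open>G - e\<close> with the shifted colors \<open>c'\<close>. Neither of the
  two summands of \<open>parking_fun\<close> can grow at any vertex, so the function is unchanged if and only if
  neither shrinks anywhere.
\<close>

lemma redundant_iff:
  assumes m: "m \<in> verts G" and pos: "position G m \<tau> parent_edges = pos"
  shows "redundant G m \<tau> parent_edges e \<longleftrightarrow>
    e \<in> edges G - parent_edges - (\<Union>v\<in>verts G - R. counted_edges v)"
proof (cases "e \<in> edges G - parent_edges")
  case e: True
  let ?B = "before pos (verts G)"
  define G' where "G' = delete_edge G e"
  define c' where "c' v = (if fst e = {v, p v} \<and> snd e < c v then c v - 1 else c v)" for v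
  have snd_less: "snd e < mult G (fst e)" using e by (auto simp: edges_def)
  have other_color: "c v \<noteq> snd e" if "v \<in> verts G - R" "fst e = {v, p v}" for v
  proof
    assume "c v = snd e"
    then have "e = ({v, p v}, c v)" using that(2) by (simp add: prod_eq_iff)
    then show False using e that(1) by (auto simp: parent_edges_def)
  qed
  have verts': "verts G' = verts G" by (simp add: G'_def)
  interpret D: parent_forest G' m pos R p c'
  proof
    show "p v \<in> verts G' \<and> pos (p v) < pos v \<and> c' v < mult G' {v, p v}"
      if v: "v \<in> verts G' - R" for v
    proof -
      have nr: "v \<in> verts G - R" using v by (simp add: verts')
      show ?thesis using parent[OF nr] other_color[OF nr] snd_less
        by (auto simp: c'_def G'_def mult_delete_edge)
    qed
  qed (use inj_pos roots root_least root_separates in \<open>auto simp: verts'\<close>)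
  have "recolor e ({v, p v}, c v) = ({v, p v}, c' v)" for v
    by (auto simp: recolor_def c'_def)
  then have F': "recolor e ` parent_edges = D.parent_edges"
    unfolding parent_edges_def D.parent_edges_def verts' image_image by simp
  have "adj D.parent_edges = adj parent_edges"
    by (intro ext) (simp add: adj_parent_edges D.adj_parent_edges verts')
  then have "next_vertex G' m \<tau> D.parent_edges = next_vertex G m \<tau> parent_edges"
    by (intro ext) (simp only: next_vertex_def verts')
  then have pos': "position G' m \<tau> D.parent_edges = pos"
    using pos m by (simp add: position_eq_rank verts')
  have "redundant G m \<tau> parent_edges e \<longleftrightarrow> D.parking_fun = parking_fun"
    using e D.forest_fun_parking_fun[of \<tau>] forest_fun_parking_fun[of \<tau>] pos pos'
    by (simp add: redundant_def F' G'_def[symmetric])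
  also have "\<dots> \<longleftrightarrow> (\<forall>v\<in>verts G - R. c' v + joins G' v (?B (p v)) = c v + joins G v (?B (p v)))"
  proof
    assume eq: "D.parking_fun = parking_fun"
    show "\<forall>v\<in>verts G - R. c' v + joins G' v (?B (p v)) = c v + joins G v (?B (p v))"
    proof
      fix v assume "v \<in> verts G - R"
      then show "c' v + joins G' v (?B (p v)) = c v + joins G v (?B (p v))"
        using fun_cong[OF eq, of v] by (simp add: parking_fun_def D.parking_fun_def verts')
    qed
  next
    assume eq: "\<forall>v\<in>verts G - R. c' v + joins G' v (?B (p v)) = c v + joins G v (?B (p v))"
    show "D.parking_fun = parking_fun"
      unfolding parking_fun_def D.parking_fun_def verts'
      by (rule restrict_ext) (use eq in simp)
  qed
  also have "\<dots> \<longleftrightarrow> (\<forall>v\<in>verts G - R. e \<notin> counted_edges v)"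
  proof (rule ball_cong[OF refl])
    fix v assume v: "v \<in> verts G - R"
    have "finite (?B (p v))" "0 < mult G (fst e)" using snd_less by (auto simp: before_def)
    note del = joins_delete_edge[OF this, of v, folded G'_def]
    have c'_eq: "c' v = c v \<longleftrightarrow> \<not> (fst e = {v, p v} \<and> snd e < c v)" by (auto simp: c'_def)
    have "c' v \<le> c v" by (simp add: c'_def)
    then have "c' v + joins G' v (?B (p v)) = c v + joins G v (?B (p v)) \<longleftrightarrow>
        c' v = c v \<and> joins G' v (?B (p v)) = joins G v (?B (p v))"
      using del(1) by linarith
    also have "\<dots> \<longleftrightarrow>
        \<not> (fst e = {v, p v} \<and> snd e < c v) \<and> \<not> (\<exists>u\<in>?B (p v). fst e = {v, u})"
      using c'_eq del(2) by simp
    also have "\<dots> \<longleftrightarrow> e \<notin> counted_edges v"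
      using snd_less by (cases e) (auto simp: counted_edges_def)
    finally show "c' v + joins G' v (?B (p v)) = c v + joins G v (?B (p v)) \<longleftrightarrow>
      e \<notin> counted_edges v" .
  qed
  finally show ?thesis using e by blast
next
  case False
  then show ?thesis by (auto simp: redundant_def)
qed

text \<open>
  The edges of \<open>G\<close> split into the parent edges, one for each non-root, the redundant edges, and the
  disjoint sets of counted edges, whose sizes are the values at the non-roots. The values \<open>-1\<close> turn
  the number of non-roots into the number of vertices.
\<close>

lemma card_redundant:
  assumes m: "m \<in> verts G" and pos: "position G m \<tau> parent_edges = pos"
  shows "int (card {e. redundant G m \<tau> parent_edges e}) + int (card (verts G)) +
    (\<Sum>v\<in>verts G. parking_fun v) = int (card (edges G))"
proof -
  let ?C = "\<Union>v\<in>verts G - R. counted_edges v"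
  have finF: "finite parent_edges" using finite_subset[OF parent_edges_subset] by simp
  have C: "?C \<subseteq> edges G - parent_edges" using counted_edges_subset by blast
  have "{e. redundant G m \<tau> parent_edges e} = edges G - parent_edges - ?C"
    using redundant_iff[OF assms] by blast
  then have "card {e. redundant G m \<tau> parent_edges e} + card ?C = card (edges G - parent_edges)"
    using card_Diff_subset[OF _ C] card_mono[OF _ C] finite_subset[OF C] by simp
  moreover have "card (edges G - parent_edges) + card parent_edges = card (edges G)"
    using card_Diff_subset[OF finF parent_edges_subset] card_mono[OF _ parent_edges_subset] by simp
  moreover have "card ?C = (\<Sum>v\<in>verts G - R. card (counted_edges v))"
    using card_counted_edges counted_edges_disjoint by (intro card_UN_disjoint) auto
  ultimately have "card {e. redundant G m \<tau> parent_edges e} + card (verts G - R) +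
      (\<Sum>v\<in>verts G - R. card (counted_edges v)) = card (edges G)"
    using card_parent_edges by linarith
  moreover have "(\<Sum>v\<in>verts G - R. parking_fun v) = int (\<Sum>v\<in>verts G - R. card (counted_edges v))"
    unfolding of_nat_sum
    by (intro sum.cong) (simp_all add: parking_fun_def card_counted_edges)
  moreover have "(\<Sum>v\<in>R. parking_fun v) = - int (card R)"
    using roots by (subst sum.cong[of R R _ "\<lambda>_. -1"]) (auto simp: parking_fun_def)
  moreover have "(\<Sum>v\<in>verts G. parking_fun v) =
      (\<Sum>v\<in>verts G - R. parking_fun v) + (\<Sum>v\<in>R. parking_fun v)"
    using roots by (intro sum.subset_diff) auto
  moreover have "card (verts G) = card (verts G - R) + card R"
    using card_Int_Diff[of "verts G" R] roots by (simp add: Int_absorb1)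
  ultimately show ?thesis by linarith
qed

end

text \<open>
  Each redundant edge is counted at its later end only.
\<close>

lemma sum_redundant_count:
  assumes inj: "inj_on (position G m \<tau> F) (verts G)"
  shows "(\<Sum>i\<in>verts G. redundant_count G m \<tau> F i) = card {e. redundant G m \<tau> F e}"
proof -
  let ?pos = "position G m \<tau> F"
  let ?A = "\<lambda>i. {e. redundant G m \<tau> F e \<and> (\<exists>j\<in>verts G. fst e = {i, j} \<and> ?pos j \<le> ?pos i)}"
  have sub: "{e. redundant G m \<tau> F e} \<subseteq> edges G" by (auto simp: redundant_def)
  have fin: "finite (?A i)" for i
    using sub by (intro finite_subset[OF _ finite_edges[of G]]) auto
  have disj: "?A i \<inter> ?A j = {}" if "i \<in> verts G" "j \<in> verts G" "i \<noteq> j" for i j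
    using inj_onD[OF inj _ that(1,2)] that(3) by (auto simp: doubleton_eq_iff)
  have "e \<in> (\<Union>i\<in>verts G. ?A i)" if e: "redundant G m \<tau> F e" for e
  proof -
    obtain a b where ab: "fst e = {a, b}" "a \<in> verts G" "b \<in> verts G"
      using e sub by (fastforce simp: edges_def)
    show ?thesis
    proof (cases "?pos b \<le> ?pos a")
      case True
      then show ?thesis using e ab by blast
    next
      case False
      then have "fst e = {b, a}" "?pos a \<le> ?pos b" using ab by auto
      then show ?thesis using e ab by blast
    qed
  qed
  then have "{e. redundant G m \<tau> F e} = (\<Union>i\<in>verts G. ?A i)" by blast
  then show ?thesis
    unfolding redundant_count_def using fin disj by (simp add: card_UN_disjoint)
qed

lemma redundant_weight:
  assumes m: "m \<in> verts G" and F: "F \<in> forests G m"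
  shows "int (card (verts G)) + int (\<Sum>i\<in>verts G. redundant_count G m \<tau> F i) =
    int (card (edges G)) - (\<Sum>i\<in>verts G. forest_fun G m \<tau> F i)"
proof -
  obtain R p c where "parent_forest G m (position G m \<tau> F) R p c"
    and F_eq: "F = parent_forest.parent_edges G R p c"
    and f: "forest_fun G m \<tau> F = parent_forest.parking_fun G (position G m \<tau> F) R p c"
    using forest_parents[OF m F] by blast
  then interpret parent_forest G m "position G m \<tau> F" R p c by simp
  have "position G m \<tau> parent_edges = position G m \<tau> F" using F_eq by simp
  from card_redundant[OF m this] show ?thesis
    unfolding sum_redundant_count[OF inj_pos] f F_eq[symmetric] by linarith
qed

section \<open>Complement functions\<close>

lemma deg_split:
  assumes "I \<subseteq> verts G" "i \<in> I"
  shows "deg G i = indeg G I i + outdeg G I i"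
proof -
  have "(\<Sum>j\<in>verts G - I. if j = i then 2 * mult G {i, j} else mult G {i, j}) = outdeg G I i"
    unfolding outdeg_def using assms(2) by (intro sum.cong) auto
  moreover have "deg G i =
      (\<Sum>j\<in>verts G - I. if j = i then 2 * mult G {i, j} else mult G {i, j}) + indeg G I i"
    unfolding deg_def indeg_def by (rule sum.subset_diff[OF assms(1) finite_verts])
  ultimately show ?thesis by simp
qed

text \<open>
  Double counting with \<open>inc i e\<close>, the number of ends of \<open>e\<close> at \<open>i\<close>; a loop has both its ends at the same
  vertex.
\<close>

lemma handshake: "(\<Sum>i\<in>verts G. deg G i) = 2 * card (edges G)"
proof -
  define inc :: "nat \<Rightarrow> edge \<Rightarrow> nat" where
    "inc i e = (if fst e = {i} then 2 else if i \<in> fst e then 1 else 0)" for i e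
  have deg: "deg G i = (\<Sum>e\<in>edges G. inc i e)" if i: "i \<in> verts G" for i
  proof -
    let ?A = "Sigma (verts G) (\<lambda>j. {..<mult G {i, j}})"
    let ?g = "\<lambda>(j, k). ({i, j}, k)"
    have inj: "inj_on ?g ?A" by (auto simp: inj_on_def doubleton_eq_iff)
    have sub: "?g ` ?A \<subseteq> edges G" using i by (auto intro: edgeI)
    have out: "inc i e = 0" if e: "e \<in> edges G - ?g ` ?A" for e
    proof -
      have "i \<notin> fst e"
      proof
        assume "i \<in> fst e"
        moreover obtain a b k where ab: "e = ({a, b}, k)" "a \<in> verts G" "b \<in> verts G"
          "k < mult G {a, b}"
          using e unfolding edges_def by blast
        ultimately have "\<exists>j\<in>verts G. {a, b} = {i, j}" by auto
        then obtain j where "fst e = {i, j}" "j \<in> verts G" "snd e < mult G {i, j}"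
          using ab by auto
        then have "e = ?g (j, snd e)" "(j, snd e) \<in> ?A" by (auto simp: prod_eq_iff)
        then show False using e by blast
      qed
      then show ?thesis by (auto simp: inc_def)
    qed
    have "(\<Sum>e\<in>edges G. inc i e) = (\<Sum>e\<in>?g ` ?A. inc i e)"
      using sub out by (intro sum.mono_neutral_right) auto
    also have "\<dots> = (\<Sum>(j, k)\<in>?A. inc i ({i, j}, k))"
      by (subst sum.reindex[OF inj]) (simp add: case_prod_unfold)
    also have "\<dots> = (\<Sum>j\<in>verts G. \<Sum>k<mult G {i, j}. inc i ({i, j}, k))"
      by (subst sum.Sigma) auto
    also have "\<dots> = deg G i"
      unfolding deg_def by (intro sum.cong) (auto simp: inc_def)
    finally show ?thesis by simp
  qed
  have two: "(\<Sum>i\<in>verts G. inc i e) = 2" if eG: "e \<in> edges G" for e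
  proof -
    obtain a b k where e: "e = ({a, b}, k)" "a \<in> verts G" "b \<in> verts G"
      using eG unfolding edges_def by blast
    have "(\<Sum>i\<in>verts G. inc i e) = (\<Sum>i\<in>{a, b}. inc i e)"
      using e by (intro sum.mono_neutral_right) (auto simp: inc_def)
    also have "\<dots> = 2" using e(1) by (cases "a = b") (auto simp: inc_def)
    finally show ?thesis .
  qed
  have "(\<Sum>i\<in>verts G. deg G i) = (\<Sum>e\<in>edges G. \<Sum>i\<in>verts G. inc i e)"
    by (simp add: deg sum.swap[of _ "edges G"])
  also have "\<dots> = 2 * card (edges G)" by (simp add: two)
  finally show ?thesis .
qed

text \<open>
  The condition for a singleton keeps the complement \<open>deg G i - f i\<close> nonnegative, so truncation at
  \<open>0\<close> is harmless in \<open>bij_betw_complement\<close>.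
\<close>

lemma multiparking_bounds:
  assumes f: "f \<in> multiparking G m" and i: "i \<in> verts G"
  shows "-1 \<le> f i \<and> f i \<le> int (deg G i)"
proof -
  have "{i} \<subseteq> verts G \<and> {i} \<noteq> {}" using i by simp
  then have "((\<exists>j\<in>{i}. m \<le> j) \<and> f (alpha {i} m) = -1) \<or>
      (\<exists>j\<in>{i}. 0 \<le> f j \<and> f j < int (outdeg G {i} j))"
    using f unfolding multiparking_def by blast
  moreover have "alpha {i} m = i" if "m \<le> i" using that by (intro alpha_eqI) auto
  ultimately show ?thesis using deg_split[of "{i}" G i] i by auto
qed

text \<open>
  The condition for a singleton keeps \<open>deg G i - h i\<close> in the range \<open>{-1..}\<close> required of a multiparking
  function.
\<close>

lemma multiparking_compl_bound:
  assumes h: "h \<in> multiparking_compl G m" and i: "i \<in> verts G"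
  shows "h i \<le> deg G i + 1"
proof -
  have "{i} \<subseteq> verts G \<and> {i} \<noteq> {}" using i by simp
  then have "((\<exists>j\<in>{i}. m \<le> j) \<and> h (alpha {i} m) = deg G (alpha {i} m) + 1) \<or>
      (\<exists>j\<in>{i}. indeg G {i} j < h j \<and> h j \<le> deg G j)"
    using h unfolding multiparking_compl_def by blast
  moreover have "alpha {i} m = i" if "m \<le> i" using that by (intro alpha_eqI) auto
  ultimately show ?thesis by auto
qed

text \<open>
  Since \<open>deg\<close> is the sum of \<open>indeg\<close> and \<open>outdeg\<close>, the defining conditions correspond one set \<open>I\<close> at a
  time.
\<close>

lemma complement_condition:
  assumes compl: "\<And>i. i \<in> verts G \<Longrightarrow> int (h i) = int (deg G i) - f i" and I: "I \<subseteq> verts G"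
  shows "(\<exists>i\<in>I. m \<le> i) \<and> f (alpha I m) = -1 \<or> (\<exists>i\<in>I. 0 \<le> f i \<and> f i < int (outdeg G I i)) \<longleftrightarrow>
    (\<exists>i\<in>I. m \<le> i) \<and> h (alpha I m) = deg G (alpha I m) + 1 \<or>
    (\<exists>i\<in>I. indeg G I i < h i \<and> h i \<le> deg G i)"
proof -
  have "0 \<le> f i \<and> f i < int (outdeg G I i) \<longleftrightarrow> indeg G I i < h i \<and> h i \<le> deg G i"
    if "i \<in> I" for i
    using compl[of i] deg_split[OF I that] that I by auto
  moreover have "f (alpha I m) = -1 \<longleftrightarrow> h (alpha I m) = deg G (alpha I m) + 1" if "\<exists>i\<in>I. m \<le> i"
  proof -
    have "alpha I m \<in> verts G"
      using alpha_least[OF finite_subset[OF I finite_verts] that] I by blast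
    then show ?thesis using compl[of "alpha I m"] by linarith
  qed
  ultimately show ?thesis by blast
qed

lemma bij_betw_complement:
  "bij_betw (\<lambda>f. \<lambda>i\<in>verts G. nat (int (deg G i) - f i)) (multiparking G m) (multiparking_compl G m)"
proof (rule bij_betw_byWitness[where f' = "\<lambda>h. \<lambda>i\<in>verts G. int (deg G i) - int (h i)"])
  show "\<forall>f\<in>multiparking G m. (\<lambda>i\<in>verts G. int (deg G i) -
      int ((\<lambda>i\<in>verts G. nat (int (deg G i) - f i)) i)) = f"
  proof
    fix f assume f: "f \<in> multiparking G m"
    then have "f \<in> extensional (verts G)" by (auto simp: multiparking_def PiE_def)
    then show "(\<lambda>i\<in>verts G. int (deg G i) - int ((\<lambda>i\<in>verts G. nat (int (deg G i) - f i)) i)) = f"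
      using multiparking_bounds[OF f] by (intro ext) (auto simp: extensional_def)
  qed
  show "\<forall>h\<in>multiparking_compl G m. (\<lambda>i\<in>verts G. nat (int (deg G i) -
      (\<lambda>i\<in>verts G. int (deg G i) - int (h i)) i)) = h"
    by (auto simp: multiparking_compl_def PiE_def extensional_def)
  show "(\<lambda>f. \<lambda>i\<in>verts G. nat (int (deg G i) - f i)) ` multiparking G m \<subseteq> multiparking_compl G m"
  proof safe
    fix f assume f: "f \<in> multiparking G m"
    let ?h = "\<lambda>i\<in>verts G. nat (int (deg G i) - f i)"
    have "int (?h i) = int (deg G i) - f i" if "i \<in> verts G" for i
      using multiparking_bounds[OF f that] that by simp
    from complement_condition[OF this] show "?h \<in> multiparking_compl G m"
      using f unfolding multiparking_def multiparking_compl_def by auto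
  qed
  show "(\<lambda>h. \<lambda>i\<in>verts G. int (deg G i) - int (h i)) ` multiparking_compl G m \<subseteq> multiparking G m"
  proof safe
    fix h assume h: "h \<in> multiparking_compl G m"
    let ?f = "\<lambda>i\<in>verts G. int (deg G i) - int (h i)"
    have "int (h i) = int (deg G i) - ?f i" if "i \<in> verts G" for i
      using that by simp
    note cond = complement_condition[OF this]
    have "?f \<in> verts G \<rightarrow>\<^sub>E {-1..}"
      using multiparking_compl_bound[OF h] by fastforce
    then show "?f \<in> multiparking G m"
      using h cond unfolding multiparking_def multiparking_compl_def by auto
  qed
qed

section \<open>Generating functions\<close>

lemma qpow_mult: "qpow a * qpow b = qpow (a + b)"
  by (simp add: qpow_def mult_single)

lemma subst_inverse_q_superset:
  assumes "finite K" "Poly_Mapping.keys p \<subseteq> K"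
  shows "subst_inverse_q p = (\<Sum>k\<in>K. Poly_Mapping.single (- k) (Poly_Mapping.lookup p k))"
  unfolding subst_inverse_q_def using assms
  by (intro sum.mono_neutral_left) (auto simp: in_keys_iff)

lemma subst_inverse_q_add: "subst_inverse_q (p + p') = subst_inverse_q p + subst_inverse_q p'"
proof -
  let ?K = "Poly_Mapping.keys p \<union> Poly_Mapping.keys p'"
  have "finite ?K" "Poly_Mapping.keys (p + p') \<subseteq> ?K"
    by (simp_all add: Poly_Mapping.keys_add)
  then show ?thesis
    by (simp add: subst_inverse_q_superset[of ?K] lookup_add single_add sum.distrib)
qed

lemma subst_inverse_q_sum:
  "subst_inverse_q (\<Sum>x\<in>A. qpow (w x)) = (\<Sum>x\<in>A. qpow (- w x))"
proof -
  have "subst_inverse_q (qpow k) = qpow (- k)" for k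
    by (simp add: subst_inverse_q_def qpow_def)
  then show ?thesis
    using sum_comp_morphism[of subst_inverse_q "\<lambda>x. qpow (w x)" A]
    by (simp add: subst_inverse_q_add o_def) (simp add: subst_inverse_q_def)
qed

theorem theorem3p1:
  fixes G :: multigraph and m :: nat and \<tau> :: "nat \<Rightarrow> nat"
  assumes "connected_graph G"
    and "m \<in> verts G"
    and "\<tau> permutes verts G"
  shows "qpow (int (card (verts G))) * I_poly G m \<tau> = Pbar_poly G m \<and>
    Pbar_poly G m = qpow (int (card (edges G))) * subst_inverse_q (P_poly G m)"
proof -
  let ?E = "int (card (edges G))" and ?w = "\<lambda>f. \<Sum>i\<in>verts G. f i"
  have "qpow (int (card (verts G))) * I_poly G m \<tau> =
      (\<Sum>F\<in>forests G m. qpow (?E - ?w (forest_fun G m \<tau> F)))"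
    unfolding I_poly_def sum_distrib_left qpow_mult
    using redundant_weight[OF assms(2)] by (intro sum.cong) auto
  also have "\<dots> = (\<Sum>f\<in>multiparking G m. qpow (?E - ?w f))"
    by (rule sum.reindex_bij_betw[OF bij_betw_forest_fun[OF assms(2)]])
  finally have forests: "qpow (int (card (verts G))) * I_poly G m \<tau> =
      (\<Sum>f\<in>multiparking G m. qpow (?E - ?w f))" .
  have weight: "int (\<Sum>i\<in>verts G. (\<lambda>i\<in>verts G. nat (int (deg G i) - f i)) i) - ?E = ?E - ?w f"
    if f: "f \<in> multiparking G m" for f
  proof -
    have "int (\<Sum>i\<in>verts G. (\<lambda>i\<in>verts G. nat (int (deg G i) - f i)) i) =
        (\<Sum>i\<in>verts G. int (deg G i) - f i)"
      unfolding of_nat_sum using multiparking_bounds[OF f] by (intro sum.cong) auto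
    also have "\<dots> = int (\<Sum>i\<in>verts G. deg G i) - ?w f" by (simp add: sum_subtractf)
    finally show ?thesis by (simp add: handshake)
  qed
  have compl: "Pbar_poly G m = (\<Sum>f\<in>multiparking G m. qpow (?E - ?w f))"
    unfolding Pbar_poly_def
    by (subst sum.reindex_bij_betw[OF bij_betw_complement, symmetric], rule sum.cong)
      (simp_all only: weight)
  have "qpow ?E * subst_inverse_q (P_poly G m) = (\<Sum>f\<in>multiparking G m. qpow (?E - ?w f))"
    unfolding P_poly_def subst_inverse_q_sum sum_distrib_left qpow_mult by simp
  then show ?thesis using forests compl by simp
qed

end
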